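(* Let $(E,\tau,M,\rho)$ be a Lie algebroid on a smooth manifold $M$. The Lie derivative $\mathcal L_\rho(V)$ on $\Omega(M,E)$ with respect to sections $V\in A^1(M,E)$ has the following properties. 1. For each $V\in A^1(M,E)$ and $f\in C^\infty(M,\mathbb R)$, $\mathcal L_\rho(V)(d_\rho f)=d_\rho\bigl(\mathcal L_\rho(V)f\bigr)$. 2. For each $V,W\in A^1(M,E)$ and $\eta\in\Omega(M,E)$, $i\bigl(\{V,W\}\bigr)\eta=\bigl(\mathcal L_\rho(V)\circ i(W)-i(W)\circ\mathcal L_\rho(V)\bigr)\eta$. 3. For each $V\in A^1(M,E)$, $\mathcal L_\rho(V)$ is a derivation of degree $0$ of the exterior algebra $\Omega(M,E)$: for all $\eta,\zeta\in\Omega(M,E)$, $\mathcal L_\rho(V)(\eta\wedge\zeta)=\bigl(\mathcal L_\rho(V)\eta\bigr)\wedge\zeta+\eta\wedge\bigl(\mathcal L_\rho(V)\zeta\bigr)$. 4. For each $V,W\in A^1(M,E)$ and $\eta\in\Omega(M,E)$, $\mathcal L_\rho\bigl(\{V,W\}\bigr)\eta=\bigl(\mathcal L_\rho(V)\circ\mathcal L_\rho(W)-\mathcal L_\rho(W)\circ\mathcal L_\rho(V)\bigr)\eta$. 5. For each $V\in A^1(M,E)$, $f\in C^\infty(M,\mathbb R)$ and $\eta\in\Omega(M,E)$, $\mathcal L_\rho(fV)\eta=f\mathcal L_\rho(V)\eta+d_\rho f\wedge i(V)\eta$.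
   Context: A Lie algebroid $(E,\tau,M,\rho)$ is a smooth real vector bundle $\tau:E\to M$ of finite rank over a smooth manifold, with a real Lie algebra bracket $\{\ ,\ \}$ on its smooth sections and a smooth vector bundle map $\rho:E\to TM$ over $\mathrm{id}_M$ (anchor) such that $\{s_1,fs_2\}=f\{s_1,s_2\}+(\mathcal L(\rho\circ s_1)f)s_2$. $A^1(M,E)$ is the space of smooth sections of $E$; $\Omega^p(M,E)$ the space of smooth sections of $\bigwedge^pE^*$ ($C^\infty(M,\mathbb R)$ for $p=0$, $\{0\}$ for $p<0$), identified with alternating $C^\infty(M,\mathbb R)$-multilinear forms on $A^1(M,E)$; $\Omega(M,E)=\bigoplus_p\Omega^p(M,E)$. The wedge product is $(\xi\wedge\eta)(V_1,\dots,V_{p+q})=\sum_\sigma\varepsilon(\sigma)\xi(V_{\sigma(1)},\dots,V_{\sigma(p)})\eta(V_{\sigma(p+1)},\dots,V_{\sigma(p+q)})$, sum over $(p,q)$-shuffles. The interior product $i(V)$ inserts $V$ as first argument and is $0$ on $\Omega^0(M,E)$. For $f\in C^\infty(M,\mathbb R)$, $d_\rho f\in\Omega^1(M,E)$ is defined by $\langle d_\rho f,V\rangle=\langle df,\rho\circ V\rangle$. $\mathcal L_\rho(V)$ is the degree $0$ linear endomorphism of $\Omega(M,E)$ with $\mathcal L_\rho(V)f=\mathcal L(\rho\circ V)f$ for functions and, for $\eta\in\Omega^p(M,E)$, $p>0$, $(\mathcal L_\rho(V)\eta)(V_1,\dots,V_p)=\mathcal L_\rho(V)(\eta(V_1,\dots,V_p))-\sum_{i=1}^p\eta(V_1,\dots,V_{i-1},\{V,V_i\},V_{i+1},\dots,V_p)$.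 *)

theory Defs
  imports
    "HOL-Analysis.Analysis"
    "HOL-Combinatorics.Permutations"
    "HOL-Library.Function_Algebras"
begin

section \<open>Smooth maps between Euclidean spaces\<close>

text \<open>
  Model spaces are finite-dimensional real inner product spaces. In contrast to
  \<^class>\<open>euclidean_space\<close> this admits dimension 0, hence 0-dimensional manifolds and
  vector bundles of rank 0.
\<close>

definition finite_dimensional :: "'a::real_vector itself \<Rightarrow> bool" where
  "finite_dimensional T \<longleftrightarrow> (\<exists>B::'a set. finite B \<and> span B = UNIV)"

text \<open>Meant for open \<open>S\<close> and finite-dimensional \<open>'a\<close>.\<close>

fun Ck_on :: "nat \<Rightarrow> 'a::real_normed_vector set \<Rightarrow> ('a \<Rightarrow> 'b::real_normed_vector) \<Rightarrow> bool" where
  "Ck_on 0 S f \<longleftrightarrow> continuous_on S f"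
| "Ck_on (Suc k) S f \<longleftrightarrow>
     (\<forall>y\<in>S. f differentiable (at y)) \<and>
     (\<forall>v. Ck_on k S (\<lambda>y. frechet_derivative f (at y) v))"

definition smooth_on :: "'a::real_normed_vector set \<Rightarrow> ('a \<Rightarrow> 'b::real_normed_vector) \<Rightarrow> bool" where
  "smooth_on S f \<longleftrightarrow> (\<forall>k. Ck_on k S f)"

section \<open>Smooth manifolds\<close>

text \<open>
  The underlying set of the manifold is the whole type \<open>'m\<close>; its smooth structure is given by an
  atlas, not necessarily maximal. In a chart \<open>(D, c)\<close> only the values of \<open>c\<close> on its domain
  \<open>D\<close> matter.
\<close>

type_synonym ('m, 'a) chart = "'m set \<times> ('m \<Rightarrow> 'a)"

definition chart_inv :: "('m, 'a) chart \<Rightarrow> 'a \<Rightarrow> 'm" where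
  "chart_inv C = inv_into (fst C) (snd C)"

definition smooth_manifold ::
  "('m::{t2_space,second_countable_topology}, 'a::real_inner) chart set \<Rightarrow> bool" where
  "smooth_manifold \<A> \<longleftrightarrow>
     finite_dimensional TYPE('a) \<and>
     (\<Union>C\<in>\<A>. fst C) = UNIV \<and>
     (\<forall>C\<in>\<A>. open (fst C) \<and> open (snd C ` fst C) \<and>
        homeomorphism (fst C) (snd C ` fst C) (snd C) (chart_inv C)) \<and>
     (\<forall>C\<in>\<A>. \<forall>C'\<in>\<A>. smooth_on (snd C ` (fst C \<inter> fst C')) (snd C' \<circ> chart_inv C))"

definition msmooth_on ::
  "('m, 'a::real_inner) chart set \<Rightarrow> 'm set \<Rightarrow> ('m \<Rightarrow> 'b::real_normed_vector) \<Rightarrow> bool" where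
  "msmooth_on \<A> U f \<longleftrightarrow> (\<forall>C\<in>\<A>. smooth_on (snd C ` (fst C \<inter> U)) (f \<circ> chart_inv C))"

definition smooth_functions :: "('m, 'a::real_inner) chart set \<Rightarrow> ('m \<Rightarrow> real) set" where
  "smooth_functions \<A> = {f. msmooth_on \<A> UNIV f}"

section \<open>Smooth vector bundles\<close>

text \<open>
  A bundle has a total space (a subset of the type \<open>'e\<close>), a projection, operations that are only
  meaningful within one fibre, and a set of local trivialisations \<open>(U, \<phi>)\<close>, where \<open>\<phi>\<close> is the
  second component of the usual map from the part of the bundle over \<open>U\<close> to \<open>U \<times> 'v\<close>.
\<close>

record ('e, 'm, 'v) vbundle =
  vb_total :: "'e set"
  vb_proj :: "'e \<Rightarrow> 'm"
  vb_add :: "'e \<Rightarrow> 'e \<Rightarrow> 'e"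
  vb_zero :: "'m \<Rightarrow> 'e"
  vb_scale :: "real \<Rightarrow> 'e \<Rightarrow> 'e"
  vb_trivs :: "('m set \<times> ('e \<Rightarrow> 'v)) set"

definition fibre :: "('e, 'm, 'v) vbundle \<Rightarrow> 'm \<Rightarrow> 'e set" where
  "fibre B x = {e \<in> vb_total B. vb_proj B e = x}"

definition is_real_vector_space ::
  "'e set \<Rightarrow> ('e \<Rightarrow> 'e \<Rightarrow> 'e) \<Rightarrow> 'e \<Rightarrow> (real \<Rightarrow> 'e \<Rightarrow> 'e) \<Rightarrow> bool" where
  "is_real_vector_space S add z scl \<longleftrightarrow>
     z \<in> S \<and> (\<forall>u\<in>S. \<forall>v\<in>S. add u v \<in> S) \<and> (\<forall>r. \<forall>u\<in>S. scl r u \<in> S) \<and>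
     (\<forall>u\<in>S. \<forall>v\<in>S. \<forall>w\<in>S. add (add u v) w = add u (add v w)) \<and>
     (\<forall>u\<in>S. \<forall>v\<in>S. add u v = add v u) \<and>
     (\<forall>u\<in>S. add z u = u) \<and>
     (\<forall>u\<in>S. \<exists>v\<in>S. add u v = z) \<and>
     (\<forall>r. \<forall>u\<in>S. \<forall>v\<in>S. scl r (add u v) = add (scl r u) (scl r v)) \<and>
     (\<forall>r s. \<forall>u\<in>S. scl (r + s) u = add (scl r u) (scl s u)) \<and>
     (\<forall>r s. \<forall>u\<in>S. scl (r * s) u = scl r (scl s u)) \<and>
     (\<forall>u\<in>S. scl 1 u = u)"

text \<open>
  Smoothness of the map \<open>(x, v) \<mapsto> g x v\<close> on the open subset \<open>U \<times> 'v\<close> of the product manifold.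
\<close>

definition smooth_fibre_map_on ::
  "('m, 'a::real_inner) chart set \<Rightarrow> 'm set \<Rightarrow> ('m \<Rightarrow> 'v::real_inner \<Rightarrow> 'w::real_inner) \<Rightarrow> bool" where
  "smooth_fibre_map_on \<A> U g \<longleftrightarrow>
     (\<forall>C\<in>\<A>. smooth_on ((snd C ` (fst C \<inter> U)) \<times> UNIV) (\<lambda>(y, v). g (chart_inv C y) v))"

text \<open>
  The manifold structure of the total space is the one for which the trivialisations are
  diffeomorphisms; it is well defined because the transition maps are smooth.
\<close>

definition smooth_vector_bundle ::
  "('m::topological_space, 'a::real_inner) chart set \<Rightarrow> ('e, 'm, 'v::real_inner) vbundle \<Rightarrow> bool" where
  "smooth_vector_bundle \<A> B \<longleftrightarrow>
     finite_dimensional TYPE('v) \<and>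
     (\<forall>x. is_real_vector_space (fibre B x) (vb_add B) (vb_zero B x) (vb_scale B)) \<and>
     (\<Union>(U, \<phi>)\<in>vb_trivs B. U) = UNIV \<and>
     (\<forall>(U, \<phi>)\<in>vb_trivs B. open U \<and>
        (\<forall>x\<in>U. bij_betw \<phi> (fibre B x) UNIV \<and>
          (\<forall>u\<in>fibre B x. \<forall>v\<in>fibre B x. \<phi> (vb_add B u v) = \<phi> u + \<phi> v) \<and>
          (\<forall>r. \<forall>u\<in>fibre B x. \<phi> (vb_scale B r u) = r *\<^sub>R \<phi> u))) \<and>
     (\<forall>(U, \<phi>)\<in>vb_trivs B. \<forall>(W, \<psi>)\<in>vb_trivs B.
        smooth_fibre_map_on \<A> (U \<inter> W) (\<lambda>x v. \<psi> (inv_into (fibre B x) \<phi> v)))"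

definition sections ::
  "('m, 'a::real_inner) chart set \<Rightarrow> ('e, 'm, 'v::real_inner) vbundle \<Rightarrow> ('m \<Rightarrow> 'e) set" where
  "sections \<A> B =
     {s. (\<forall>x. s x \<in> fibre B x) \<and> (\<forall>(U, \<phi>)\<in>vb_trivs B. msmooth_on \<A> U (\<lambda>x. \<phi> (s x)))}"

definition sec_add :: "('e, 'm, 'v) vbundle \<Rightarrow> ('m \<Rightarrow> 'e) \<Rightarrow> ('m \<Rightarrow> 'e) \<Rightarrow> 'm \<Rightarrow> 'e" where
  "sec_add B s t = (\<lambda>x. vb_add B (s x) (t x))"

definition sec_scale :: "('e, 'm, 'v) vbundle \<Rightarrow> ('m \<Rightarrow> real) \<Rightarrow> ('m \<Rightarrow> 'e) \<Rightarrow> 'm \<Rightarrow> 'e" where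
  "sec_scale B f s = (\<lambda>x. vb_scale B (f x) (s x))"

text \<open>Smooth vector bundle maps over the identity of the base.\<close>

definition vector_bundle_map ::
  "('m, 'a::real_inner) chart set \<Rightarrow> ('e, 'm, 'v::real_inner) vbundle \<Rightarrow>
    ('e2, 'm, 'w::real_inner) vbundle \<Rightarrow> ('e \<Rightarrow> 'e2) \<Rightarrow> bool" where
  "vector_bundle_map \<A> B B' h \<longleftrightarrow>
     (\<forall>x. \<forall>u\<in>fibre B x. h u \<in> fibre B' x) \<and>
     (\<forall>x. \<forall>u\<in>fibre B x. \<forall>v\<in>fibre B x. h (vb_add B u v) = vb_add B' (h u) (h v)) \<and>
     (\<forall>x r. \<forall>u\<in>fibre B x. h (vb_scale B r u) = vb_scale B' r (h u)) \<and>
     (\<forall>(U, \<phi>)\<in>vb_trivs B. \<forall>(W, \<psi>)\<in>vb_trivs B'.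
        smooth_fibre_map_on \<A> (U \<inter> W) (\<lambda>x v. \<psi> (h (inv_into (fibre B x) \<phi> v))))"

section \<open>The tangent bundle\<close>

text \<open>
  A tangent vector at \<open>x\<close> is a pair \<open>(x, v)\<close>, where \<open>v\<close> assigns to each chart around \<open>x\<close> a coordinate
  vector such that these are related by the derivatives of the coordinate changes. For all other
  arguments \<open>v\<close> is set to 0, so that equality of tangent vectors is equality of pairs.
\<close>

type_synonym ('m, 'a) tvector = "'m \<times> (('m, 'a) chart \<Rightarrow> 'a)"

definition tangent_space ::
  "('m, 'a::real_inner) chart set \<Rightarrow> 'm \<Rightarrow> (('m, 'a) chart \<Rightarrow> 'a) set" where
  "tangent_space \<A> x =
     {v. (\<forall>C\<in>\<A>. \<forall>C'\<in>\<A>. x \<in> fst C \<and> x \<in> fst C' \<longrightarrow>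
            v C' = frechet_derivative (snd C' \<circ> chart_inv C) (at (snd C x)) (v C)) \<and>
         (\<forall>C. \<not> (C \<in> \<A> \<and> x \<in> fst C) \<longrightarrow> v C = 0)}"

definition tangent_bundle ::
  "('m, 'a::real_inner) chart set \<Rightarrow> (('m, 'a) tvector, 'm, 'a) vbundle" where
  "tangent_bundle \<A> =
     \<lparr>vb_total = (SIGMA x:UNIV. tangent_space \<A> x),
      vb_proj = fst,
      vb_add = (\<lambda>(x, v) (y, w). (x, \<lambda>C. v C + w C)),
      vb_zero = (\<lambda>x. (x, \<lambda>C. 0)),
      vb_scale = (\<lambda>r (x, v). (x, \<lambda>C. r *\<^sub>R v C)),
      vb_trivs = (\<lambda>C. (fst C, \<lambda>(x, v). v C)) ` \<A>\<rparr>"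

text \<open>
  The pairing of \<open>df\<close> with a tangent vector; the result does not depend on the chosen chart.
\<close>

definition differential ::
  "('m, 'a::real_inner) chart set \<Rightarrow> ('m \<Rightarrow> real) \<Rightarrow> ('m, 'a) tvector \<Rightarrow> real" where
  "differential \<A> f t =
     (let C = (SOME C. C \<in> \<A> \<and> fst t \<in> fst C)
      in frechet_derivative (f \<circ> chart_inv C) (at (snd C (fst t))) (snd t C))"

text \<open>The Lie derivative of a function with respect to a vector field.\<close>

definition lie_fun ::
  "('m, 'a::real_inner) chart set \<Rightarrow> ('m \<Rightarrow> ('m, 'a) tvector) \<Rightarrow> ('m \<Rightarrow> real) \<Rightarrow> 'm \<Rightarrow> real" where
  "lie_fun \<A> X f = (\<lambda>x. differential \<A> f (X x))"

section \<open>Lie algebroids\<close>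

locale lie_algebroid =
  fixes \<A> :: "('m::{t2_space,second_countable_topology}, 'a::real_inner) chart set"
    and E :: "('e, 'm, 'v::real_inner) vbundle"
    and br :: "('m \<Rightarrow> 'e) \<Rightarrow> ('m \<Rightarrow> 'e) \<Rightarrow> ('m \<Rightarrow> 'e)"
    and \<rho> :: "'e \<Rightarrow> ('m, 'a) tvector"
  assumes base: "smooth_manifold \<A>"
    and vbundle: "smooth_vector_bundle \<A> E"
    and br_closed: "\<And>s t. s \<in> sections \<A> E \<Longrightarrow> t \<in> sections \<A> E \<Longrightarrow> br s t \<in> sections \<A> E"
    and br_add_left: "\<And>s t u. s \<in> sections \<A> E \<Longrightarrow> t \<in> sections \<A> E \<Longrightarrow> u \<in> sections \<A> E \<Longrightarrow>
      br (sec_add E s t) u = sec_add E (br s u) (br t u)"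
    and br_add_right: "\<And>s t u. s \<in> sections \<A> E \<Longrightarrow> t \<in> sections \<A> E \<Longrightarrow> u \<in> sections \<A> E \<Longrightarrow>
      br u (sec_add E s t) = sec_add E (br u s) (br u t)"
    and br_scale_left: "\<And>r s t. s \<in> sections \<A> E \<Longrightarrow> t \<in> sections \<A> E \<Longrightarrow>
      br (sec_scale E (\<lambda>_. r) s) t = sec_scale E (\<lambda>_. r) (br s t)"
    and br_scale_right: "\<And>r s t. s \<in> sections \<A> E \<Longrightarrow> t \<in> sections \<A> E \<Longrightarrow>
      br s (sec_scale E (\<lambda>_. r) t) = sec_scale E (\<lambda>_. r) (br s t)"
    and br_alternating: "\<And>s. s \<in> sections \<A> E \<Longrightarrow> br s s = vb_zero E"
    and jacobi: "\<And>s t u. s \<in> sections \<A> E \<Longrightarrow> t \<in> sections \<A> E \<Longrightarrow> u \<in> sections \<A> E \<Longrightarrow>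
      sec_add E (br s (br t u)) (sec_add E (br t (br u s)) (br u (br s t))) = vb_zero E"
    and anchor: "vector_bundle_map \<A> E (tangent_bundle \<A>) \<rho>"
    and leibniz: "\<And>f s t. f \<in> smooth_functions \<A> \<Longrightarrow> s \<in> sections \<A> E \<Longrightarrow> t \<in> sections \<A> E \<Longrightarrow>
      br s (sec_scale E f t) =
        sec_add E (sec_scale E f (br s t)) (sec_scale E (lie_fun \<A> (\<rho> \<circ> s) f) t)"

section \<open>Forms\<close>

text \<open>
  A form, possibly inhomogeneous, is a function on finite lists of sections, whose
  component of degree \<open>p\<close> is its restriction to the lists of length \<open>p\<close>. It vanishes on lists
  not consisting of smooth sections. Addition and multiplication of forms and of functions are
  pointwise; for a function \<open>f\<close>, the product of \<open>f\<close> with a form \<open>\<eta>\<close> is \<open>\<lambda>Vs. f * \<eta> Vs\<close>.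
\<close>

type_synonym ('m, 'e) form = "('m \<Rightarrow> 'e) list \<Rightarrow> 'm \<Rightarrow> real"

text \<open>
  Homogeneous forms of degree \<open>p\<close>: alternating forms on the sections, multilinear over the ring of
  smooth functions, with smooth functions as values.
\<close>

definition forms_deg ::
  "('m, 'a::real_inner) chart set \<Rightarrow> ('e, 'm, 'v::real_inner) vbundle \<Rightarrow> nat \<Rightarrow> ('m, 'e) form set" where
  "forms_deg \<A> E p =
     {\<eta>. (\<forall>Vs. \<not> (length Vs = p \<and> set Vs \<subseteq> sections \<A> E) \<longrightarrow> \<eta> Vs = 0) \<and>
         (\<forall>Vs. length Vs = p \<and> set Vs \<subseteq> sections \<A> E \<longrightarrow>
            \<eta> Vs \<in> smooth_functions \<A> \<and>
            (\<forall>i<p. \<forall>s\<in>sections \<A> E. \<forall>t\<in>sections \<A> E.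
               \<eta> (Vs[i := sec_add E s t]) = \<eta> (Vs[i := s]) + \<eta> (Vs[i := t])) \<and>
            (\<forall>i<p. \<forall>f\<in>smooth_functions \<A>. \<forall>s\<in>sections \<A> E.
               \<eta> (Vs[i := sec_scale E f s]) = f * \<eta> (Vs[i := s])) \<and>
            (\<forall>i<p. \<forall>j<p. i \<noteq> j \<and> Vs ! i = Vs ! j \<longrightarrow> \<eta> Vs = 0))}"

text \<open>The direct sum of the spaces of homogeneous forms.\<close>

definition forms ::
  "('m, 'a::real_inner) chart set \<Rightarrow> ('e, 'm, 'v::real_inner) vbundle \<Rightarrow> ('m, 'e) form set" where
  "forms \<A> E = {(\<Sum>p\<le>N. \<omega> p) | N \<omega>. \<forall>p. \<omega> p \<in> forms_deg \<A> E p}"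

text \<open>Functions as forms of degree 0.\<close>

definition fun_form :: "('m \<Rightarrow> real) \<Rightarrow> ('m, 'e) form" where
  "fun_form f = (\<lambda>Vs. if Vs = [] then f else 0)"

definition shuffles_perm :: "nat \<Rightarrow> nat \<Rightarrow> (nat \<Rightarrow> nat) set" where
  "shuffles_perm p q =
     {\<sigma>. \<sigma> permutes {..<p + q} \<and> strict_mono_on {..<p} \<sigma> \<and> strict_mono_on {p..<p + q} \<sigma>}"

text \<open>
  On a list of length \<open>n\<close>, the components of degrees \<open>p\<close> and \<open>n - p\<close> are multiplied for each
  \<open>p \<le> n\<close>; for homogeneous factors a single \<open>p\<close> contributes.
\<close>

definition wedge :: "('m, 'e) form \<Rightarrow> ('m, 'e) form \<Rightarrow> ('m, 'e) form" where
  "wedge \<xi> \<eta> = (\<lambda>Vs x. \<Sum>p\<le>length Vs. \<Sum>\<sigma>\<in>shuffles_perm p (length Vs - p).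
     of_int (sign \<sigma>) * \<xi> (map (\<lambda>i. Vs ! \<sigma> i) [0..<p]) x
                     * \<eta> (map (\<lambda>i. Vs ! \<sigma> i) [p..<length Vs]) x)"

text \<open>If \<open>\<eta>\<close> has degree 0, it vanishes on non-empty lists, so its interior product is 0.\<close>

definition int_prod :: "('m \<Rightarrow> 'e) \<Rightarrow> ('m, 'e) form \<Rightarrow> ('m, 'e) form" where
  "int_prod V \<eta> = (\<lambda>Vs. \<eta> (V # Vs))"

definition d_rho ::
  "('m, 'a::real_inner) chart set \<Rightarrow> ('e, 'm, 'v::real_inner) vbundle \<Rightarrow> ('e \<Rightarrow> ('m, 'a) tvector) \<Rightarrow>
    ('m \<Rightarrow> real) \<Rightarrow> ('m, 'e) form" where
  "d_rho \<A> E \<rho> f = (\<lambda>Vs. if length Vs = 1 \<and> set Vs \<subseteq> sections \<A> E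
     then (\<lambda>x. differential \<A> f (\<rho> (hd Vs x))) else 0)"

definition lie_form ::
  "('m, 'a::real_inner) chart set \<Rightarrow> ('e, 'm, 'v::real_inner) vbundle \<Rightarrow>
    (('m \<Rightarrow> 'e) \<Rightarrow> ('m \<Rightarrow> 'e) \<Rightarrow> ('m \<Rightarrow> 'e)) \<Rightarrow> ('e \<Rightarrow> ('m, 'a) tvector) \<Rightarrow>
    ('m \<Rightarrow> 'e) \<Rightarrow> ('m, 'e) form \<Rightarrow> ('m, 'e) form" where
  "lie_form \<A> E br \<rho> V \<eta> = (\<lambda>Vs. if set Vs \<subseteq> sections \<A> E
     then lie_fun \<A> (\<rho> \<circ> V) (\<eta> Vs) - (\<Sum>i<length Vs. \<eta> (Vs[i := br V (Vs ! i)]))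
     else 0)"

lemma lie_fun_zero: "lie_fun \<A> X 0 = 0"
proof -
  have "frechet_derivative (\<lambda>_. 0::real) (at y) = (\<lambda>_. 0)" for y :: 'b
    using frechet_derivative_at[OF has_derivative_const] by metis
  then show ?thesis
    by (auto simp: lie_fun_def differential_def Let_def comp_def zero_fun_def fun_eq_iff)
qed

lemma lie_form_fun_form:
  "lie_form \<A> E br \<rho> V (fun_form f) = fun_form (lie_fun \<A> (\<rho> \<circ> V) f)"
proof -
  have "(\<Sum>i<length Vs. fun_form f (Vs[i := br V (Vs ! i)])) = 0" for Vs
    by (rule sum.neutral) (auto simp: fun_form_def)
  then show ?thesis
    by (auto simp: lie_form_def fun_form_def fun_eq_iff lie_fun_zero)
qed

end

theory Submission imports Defs
begin

text \<open>
  Each identity is obtained by expanding both sides on sections. The identities involving two Lie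
  derivatives need in addition that the anchor is a bracket homomorphism,
  \<open>\<L>({s, t}) = [\<L>(s), \<L>(t)]\<close> on functions, which is a consequence of the Jacobi identity for
  \<open>s\<close>, \<open>t\<close>, \<open>f U\<close> and the Leibniz rule. That \<open>\<L>(s) f\<close> is again smooth follows by writing it in a
  chart as the derivative of \<open>f\<close> applied to a smooth vector-valued function.
\<close>

section \<open>Calculus of smooth maps\<close>

text \<open>\<open>Ck_on\<close> differentiates repeatedly in fixed directions, whereas the chain
  rule and the derivative of a function along a vector field involve directions that vary with the
  point. Expanding the varying direction in a finite orthonormal system removes this mismatch. Such
  systems come from Gram-Schmidt, since the model spaces carry no canonical basis and may have
  dimension 0. Fibre operations make sense within a single fibre only, and a bundle has no
  subtraction. Equations between sections are therefore tested after an injective linear map from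
  the fibre to the model space, where they become vector arithmetic; minus signs are moved into the
  scaling function. Smoothness of \<L>(s) f matters because the Leibniz rule and the linearity of
  forms accept smooth coefficients, and second Lie derivatives feed \<L>(s) f back into these rules.
  Shuffles enter in two ways: the product rule for the wedge holds for each shuffle separately, as a
  relabelling of the arguments, while the rule for f V requires listing the (1,q)-shuffles with
  their signs.\<close>

lemma Ck_on_cong:
  assumes "open S" "\<And>y. y \<in> S \<Longrightarrow> f y = g y" "Ck_on k S f"
  shows "Ck_on k S g"
  using assms
proof (induction k arbitrary: f g)
  case 0
  then show ?case using continuous_on_cong[of S S f g] by simp
next
  case (Suc k)
  \<comment> \<open>Derivatives in \<open>Ck_on\<close> are taken in the whole space, not within
    \<open>S\<close>; openness of \<open>S\<close> makes them depend on the values on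
    \<open>S\<close> alone.\<close>
  have der: "(g has_derivative frechet_derivative f (at y)) (at y)" if "y \<in> S" for y
  proof (rule has_derivative_transform_within_open[OF _ \<open>open S\<close> that])
    show "(f has_derivative frechet_derivative f (at y)) (at y)"
      using Suc.prems(3) that by (simp flip: frechet_derivative_works)
  qed (rule Suc.prems(2))
  have eq: "frechet_derivative g (at y) = frechet_derivative f (at y)" if "y \<in> S" for y
    by (rule frechet_derivative_at[OF der[OF that], symmetric])
  have "Ck_on k S (\<lambda>y. frechet_derivative g (at y) v)" for v
    by (rule Suc.IH[OF \<open>open S\<close>, of "\<lambda>y. frechet_derivative f (at y) v"])
      (use Suc.prems eq in auto)
  moreover have "g differentiable (at y)" if "y \<in> S" for y
    using der[OF that] by (rule differentiableI)
  ultimately show ?case by simp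
qed

lemma Ck_on_subset: "Ck_on k S f \<Longrightarrow> T \<subseteq> S \<Longrightarrow> Ck_on k T f"
  by (induction k arbitrary: f) (auto intro: continuous_on_subset)

lemma Ck_on_local:
  assumes "\<And>y. y \<in> S \<Longrightarrow> \<exists>T. open T \<and> y \<in> T \<and> Ck_on k T f"
  shows "Ck_on k S f"
  using assms
proof (induction k arbitrary: f)
  case 0
  show ?case
    unfolding Ck_on.simps
  proof (rule continuous_at_imp_continuous_on, rule ballI)
    fix y assume "y \<in> S"
    with 0 obtain T where "open T" "y \<in> T" "continuous_on T f" by auto
    then show "isCont f y" by (simp add: continuous_on_eq_continuous_at)
  qed
next
  case (Suc k)
  have "f differentiable (at y)" if "y \<in> S" for y
    using Suc.prems[OF that] by auto
  moreover have "Ck_on k S (\<lambda>y. frechet_derivative f (at y) v)" for v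
  proof (rule Suc.IH)
    fix y assume "y \<in> S"
    from Suc.prems[OF this] show "\<exists>T. open T \<and> y \<in> T \<and> Ck_on k T (\<lambda>y. frechet_derivative f (at y) v)"
      by auto
  qed
  ultimately show ?case by simp
qed

lemma Ck_on_SucD: "Ck_on (Suc k) S f \<Longrightarrow> Ck_on k S f"
proof (induction k arbitrary: f)
  case 0
  then show ?case
    by (auto intro!: continuous_at_imp_continuous_on differentiable_imp_continuous_within)
next
  case (Suc k)
  have "Ck_on k S (\<lambda>y. frechet_derivative f (at y) v)" for v
    by (rule Suc.IH) (use Suc.prems in simp)
  then show ?case using Suc.prems by simp
qed

text \<open>The induction step in usable form: any explicit formula \<open>D\<close> for the
  derivative on \<open>S\<close> may stand in for \<open>frechet_derivative\<close>, so the closure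
  rules below reduce to the standard differentiation rules.\<close>

lemma Ck_on_SucI:
  assumes "open S" "\<And>y. y \<in> S \<Longrightarrow> (f has_derivative D y) (at y)"
    and "\<And>v. Ck_on k S (\<lambda>y. D y v)"
  shows "Ck_on (Suc k) S f"
proof -
  have "frechet_derivative f (at y) = D y" if "y \<in> S" for y
    using assms(2)[OF that] frechet_derivative_at by metis
  then have "Ck_on k S (\<lambda>y. frechet_derivative f (at y) v)" for v
    using Ck_on_cong[OF assms(1) _ assms(3)] by simp
  with assms(2) show ?thesis by (auto simp: differentiable_def)
qed

lemma Ck_on_Suc_has_derivative:
  "Ck_on (Suc k) S f \<Longrightarrow> y \<in> S \<Longrightarrow> (f has_derivative frechet_derivative f (at y)) (at y)"
  by (simp add: frechet_derivative_works)

lemma Ck_on_const: "open S \<Longrightarrow> Ck_on k S (\<lambda>_. c)"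
proof (induction k arbitrary: c)
  case (Suc k)
  show ?case by (rule Ck_on_SucI[OF Suc.prems has_derivative_const Suc.IH[OF Suc.prems]])
qed simp

lemma Ck_on_bounded_linear:
  assumes "open S" "bounded_linear L" "Ck_on k S f"
  shows "Ck_on k S (\<lambda>y. L (f y))"
  using assms(3)
proof (induction k arbitrary: f)
  case 0
  then show ?case using bounded_linear.continuous_on[OF assms(2)] by simp
next
  case (Suc k)
  show ?case
    by (rule Ck_on_SucI[OF assms(1)
          bounded_linear.has_derivative[OF assms(2) Ck_on_Suc_has_derivative[OF Suc.prems]]])
      (use Suc in auto)
qed

lemma Ck_on_id: "open S \<Longrightarrow> Ck_on k S (\<lambda>y. y)"
proof (cases k)
  case (Suc l)
  assume "open S"
  then show ?thesis
    unfolding Suc by (intro Ck_on_SucI[OF _ has_derivative_ident] Ck_on_const)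
qed simp

lemma Ck_on_add:
  assumes "open S" "Ck_on k S f" "Ck_on k S g"
  shows "Ck_on k S (\<lambda>y. f y + g y)"
  using assms(2,3)
proof (induction k arbitrary: f g)
  case 0
  then show ?case by (simp add: continuous_on_add)
next
  case (Suc k)
  show ?case
    by (rule Ck_on_SucI[OF assms(1) has_derivative_add[OF
            Ck_on_Suc_has_derivative[OF Suc.prems(1)] Ck_on_Suc_has_derivative[OF Suc.prems(2)]]])
      (use Suc in auto)
qed

lemma Ck_on_sum:
  assumes "open S" "\<And>i. i \<in> I \<Longrightarrow> Ck_on k S (f i)"
  shows "Ck_on k S (\<lambda>y. \<Sum>i\<in>I. f i y)"
  using assms(2)
  by (induction I rule: infinite_finite_induct) (auto intro!: Ck_on_add Ck_on_const assms(1))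

lemma Ck_on_scaleR:
  fixes f :: "_ \<Rightarrow> real"
  assumes "open S" "Ck_on k S f" "Ck_on k S g"
  shows "Ck_on k S (\<lambda>y. f y *\<^sub>R g y)"
  using assms(2,3)
proof (induction k arbitrary: f g)
  case 0
  then show ?case by (simp add: continuous_on_scaleR)
next
  case (Suc k)
  \<comment> \<open>The product rule returns \<open>f\<close> and \<open>g\<close> undifferentiated,
    now needed at order \<open>k\<close>; \<open>Ck_on_SucD\<close> lowers the order.\<close>
  have "Ck_on k S (\<lambda>y. f y *\<^sub>R frechet_derivative g (at y) v + frechet_derivative f (at y) v *\<^sub>R g y)"
    for v
    by (intro Ck_on_add[OF assms(1)] Suc.IH Suc.prems[THEN Ck_on_SucD])
      (use Suc.prems in simp_all)
  then show ?case
    by (intro Ck_on_SucI[OF assms(1) has_derivative_scaleR[OF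
            Ck_on_Suc_has_derivative[OF Suc.prems(1)] Ck_on_Suc_has_derivative[OF Suc.prems(2)]]])
qed

lemma Ck_on_Pair:
  assumes "open S" "Ck_on k S f" "Ck_on k S g"
  shows "Ck_on k S (\<lambda>y. (f y, g y))"
proof -
  have "Ck_on k S (\<lambda>y. (f y, 0) + (0, g y))"
    by (intro Ck_on_add Ck_on_bounded_linear[where L="\<lambda>u. (u, 0)"]
        Ck_on_bounded_linear[where L="\<lambda>u. (0, u)"] assms
        bounded_linear_Pair bounded_linear_ident bounded_linear_zero)
  then show ?thesis by simp
qed

section \<open>Orthonormal expansions and the chain rule\<close>

text \<open>Given by the expansion formula that the proof applies, which is the identity of a finite
  Parseval frame. It tolerates a zero vector in \<open>B\<close>, and in dimension 0 the empty set
  qualifies.\<close>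

definition orthonormal_basis :: "'a::real_inner set \<Rightarrow> bool" where
  "orthonormal_basis B \<longleftrightarrow> finite B \<and> (\<forall>x. (\<Sum>b\<in>B. (x \<bullet> b) *\<^sub>R b) = x)"

text \<open>Orthogonalise a finite spanning set, discard a possible zero vector and normalise. The
  remainder \<open>z\<close> of the expansion of \<open>x\<close> is orthogonal to a spanning set,
  hence to itself, hence zero.\<close>

lemma finite_dimensional_orthonormal_basis:
  assumes "finite_dimensional TYPE('a::real_inner)"
  obtains B :: "'a::real_inner set" where "orthonormal_basis B"
proof -
  obtain B0 :: "'a set" where "finite B0" "span B0 = UNIV"
    using assms by (auto simp: finite_dimensional_def)
  then obtain C :: "'a set" where C: "finite C" "span C = UNIV" "pairwise orthogonal C"
    using basis_orthogonal[of B0] by auto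
  define N where "N = (\<lambda>c::'a. c /\<^sub>R norm c)"
  define B where "B = N ` (C - {0})"
  \<comment> \<open>Two vectors with the same normalisation are not orthogonal, so in a pairwise
    orthogonal set they coincide.\<close>
  have inj: "inj_on N (C - {0})"
  proof (rule inj_onI)
    fix c d assume cd: "c \<in> C - {0}" "d \<in> C - {0}" "N c = N d"
    have "N d \<bullet> N d \<noteq> 0" using cd(2) by (simp add: N_def)
    then have "N c \<bullet> N d \<noteq> 0" unfolding cd(3) .
    then have "\<not> orthogonal c d" by (simp add: N_def orthogonal_def)
    then show "c = d" using cd(1,2) C(3) by (auto simp only: pairwise_def)
  qed
  have "(\<Sum>b\<in>B. (x \<bullet> b) *\<^sub>R b) = (\<Sum>c\<in>C. (x \<bullet> c / (c \<bullet> c)) *\<^sub>R c)" for x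
  proof -
    have "(\<Sum>b\<in>B. (x \<bullet> b) *\<^sub>R b) = (\<Sum>c\<in>C - {0}. (x \<bullet> N c) *\<^sub>R N c)"
      unfolding B_def by (simp add: sum.reindex[OF inj])
    also have "\<dots> = (\<Sum>c\<in>C. (x \<bullet> c / (c \<bullet> c)) *\<^sub>R c)"
      using C(1) by (intro sum.mono_neutral_cong_left)
        (simp_all add: N_def divide_inverse dot_square_norm power2_eq_square)
    finally show ?thesis .
  qed
  moreover have "(\<Sum>c\<in>C. (x \<bullet> c / (c \<bullet> c)) *\<^sub>R c) = x" for x
  proof -
    define z where "z = x - (\<Sum>c\<in>C. (x \<bullet> c / (c \<bullet> c)) *\<^sub>R c)"
    have "orthogonal z d" if "d \<in> C" for d
    proof -
      have "(\<Sum>c\<in>C. (x \<bullet> c / (c \<bullet> c)) * (c \<bullet> d)) = (\<Sum>c\<in>{d}. (x \<bullet> c / (c \<bullet> c)) * (c \<bullet> d))"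
        using C that by (intro sum.mono_neutral_right) (auto simp: pairwise_def orthogonal_def)
      also have "\<dots> = x \<bullet> d" by simp
      finally show ?thesis by (simp add: z_def orthogonal_def inner_diff_left inner_sum_left)
    qed
    then have "orthogonal z z"
      using orthogonal_to_span[of z C z] C(2) by auto
    then show ?thesis by (simp add: z_def orthogonal_def)
  qed
  ultimately have "orthonormal_basis B"
    using C(1) by (simp add: orthonormal_basis_def B_def)
  then show ?thesis by (rule that)
qed

text \<open>Applied to a derivative \<open>L\<close>, this trades a direction \<open>x\<close> that
  may vary for the fixed directions in \<open>B\<close>, about which \<open>Ck_on\<close>
  speaks.\<close>

lemma linear_orthonormal_basis:
  assumes "orthonormal_basis B" "linear L"
  shows "L x = (\<Sum>b\<in>B. (x \<bullet> b) *\<^sub>R L b)"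
proof -
  have "L x = L (\<Sum>b\<in>B. (x \<bullet> b) *\<^sub>R b)" using assms by (simp add: orthonormal_basis_def)
  also have "\<dots> = (\<Sum>b\<in>B. (x \<bullet> b) *\<^sub>R L b)"
    by (simp add: linear_sum[OF assms(2)] linear_cmul[OF assms(2)])
  finally show ?thesis .
qed

text \<open>Needed to compose with maps defined on the product of a chart range and a model fibre.
  Removing 0 from \<open>C\<close> keeps the two embedded copies disjoint, since both could contain
  (0, 0), and leaves the sum unchanged.\<close>

lemma orthonormal_basis_Times:
  assumes "orthonormal_basis B" "orthonormal_basis C"
  shows "orthonormal_basis ((\<lambda>b. (b, 0)) ` B \<union> (\<lambda>c. (0, c)) ` (C - {0}))"
proof -
  have fin: "finite B" "finite C" using assms by (auto simp: orthonormal_basis_def)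
  have "(\<Sum>d\<in>(\<lambda>b. (b, 0)) ` B \<union> (\<lambda>c. (0, c)) ` (C - {0}). (z \<bullet> d) *\<^sub>R d) = z" for z
  proof -
    have "(\<Sum>d\<in>(\<lambda>b. (b, 0)) ` B \<union> (\<lambda>c. (0, c)) ` (C - {0}). (z \<bullet> d) *\<^sub>R d) =
        (\<Sum>b\<in>B. (z \<bullet> (b, 0)) *\<^sub>R (b, 0)) + (\<Sum>c\<in>C - {0}. (z \<bullet> (0, c)) *\<^sub>R (0, c))"
      using fin by (subst sum.union_disjoint) (auto simp: sum.reindex inj_on_def)
    also have "(\<Sum>c\<in>C - {0}. (z \<bullet> (0, c)) *\<^sub>R (0, c)) = (\<Sum>c\<in>C. (z \<bullet> (0, c)) *\<^sub>R (0, c))"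
      using fin by (intro sum.mono_neutral_left) (auto simp flip: zero_prod_def)
    also have "(\<Sum>b\<in>B. (z \<bullet> (b, 0)) *\<^sub>R (b, 0)) = (fst z, 0)"
      using assms(1) by (simp add: inner_prod_def sum_prod orthonormal_basis_def)
    also have "(\<Sum>c\<in>C. (z \<bullet> (0, c)) *\<^sub>R (0, c)) = (0, snd z)"
      using assms(2) by (simp add: inner_prod_def sum_prod orthonormal_basis_def)
    finally show ?thesis by simp
  qed
  with fin show ?thesis by (simp add: orthonormal_basis_def)
qed

text \<open>In the derivative of the composite, the direction in which \<open>g\<close> is
  differentiated depends on \<open>y\<close>. Its expansion in \<open>B\<close> gives a sum of
  products of a component of the derivative of \<open>f\<close> with a directional derivative of
  \<open>g\<close> after \<open>f\<close>; the latter falls under the induction hypothesis, hence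
  \<open>g\<close> is arbitrary there.\<close>

lemma Ck_on_compose:
  fixes f :: "'a::real_normed_vector \<Rightarrow> 'b::real_inner" and g :: "'b \<Rightarrow> 'c::real_normed_vector"
  assumes B: "orthonormal_basis (B :: 'b set)" and "open S" "open T"
    and "Ck_on k S f" "Ck_on k T g" "f ` S \<subseteq> T"
  shows "Ck_on k S (\<lambda>y. g (f y))"
  using assms(4-)
proof (induction k arbitrary: g)
  case 0
  then show ?case by (auto intro: continuous_on_compose2)
next
  case (Suc k)
  have der: "((\<lambda>y. g (f y)) has_derivative
      (\<lambda>v. frechet_derivative g (at (f y)) (frechet_derivative f (at y) v))) (at y)"
    if "y \<in> S" for y
    using has_derivative_compose[OF Ck_on_Suc_has_derivative[OF Suc.prems(1) that]
        Ck_on_Suc_has_derivative[OF Suc.prems(2)]] Suc.prems(3) that by auto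
  have "Ck_on k S (\<lambda>y. (frechet_derivative f (at y) v \<bullet> b) *\<^sub>R frechet_derivative g (at (f y)) b)"
    for v b
  proof (rule Ck_on_scaleR[OF \<open>open S\<close>])
    show "Ck_on k S (\<lambda>y. frechet_derivative f (at y) v \<bullet> b)"
      by (rule Ck_on_bounded_linear[OF \<open>open S\<close> bounded_linear_inner_left])
        (use Suc.prems(1) in simp)
    show "Ck_on k S (\<lambda>y. frechet_derivative g (at (f y)) b)"
      by (rule Suc.IH[OF Ck_on_SucD[OF Suc.prems(1)] _ Suc.prems(3)]) (use Suc.prems(2) in simp)
  qed
  then have sum: "Ck_on k S (\<lambda>y. \<Sum>b\<in>B. (frechet_derivative f (at y) v \<bullet> b) *\<^sub>R frechet_derivative g (at (f y)) b)"
    for v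
    by (intro Ck_on_sum \<open>open S\<close>)
  have eq: "(\<Sum>b\<in>B. (frechet_derivative f (at y) v \<bullet> b) *\<^sub>R frechet_derivative g (at (f y)) b) =
      frechet_derivative g (at (f y)) (frechet_derivative f (at y) v)" if "y \<in> S" for y v
  proof (intro linear_orthonormal_basis[OF B, symmetric] linear_frechet_derivative)
    show "g differentiable at (f y)" using Suc.prems(2,3) that by auto
  qed
  have "Ck_on k S (\<lambda>y. frechet_derivative g (at (f y)) (frechet_derivative f (at y) v))" for v
    by (rule Ck_on_cong[OF \<open>open S\<close> _ sum]) (rule eq)
  then show ?case by (intro Ck_on_SucI[OF \<open>open S\<close> der])
qed

section \<open>Closure properties of smooth maps\<close>

lemma smooth_on_cong:
  "open S \<Longrightarrow> (\<And>y. y \<in> S \<Longrightarrow> f y = g y) \<Longrightarrow> smooth_on S f \<Longrightarrow> smooth_on S g"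
  unfolding smooth_on_def using Ck_on_cong by blast

lemma smooth_on_local:
  assumes "\<And>y. y \<in> S \<Longrightarrow> \<exists>T. open T \<and> y \<in> T \<and> smooth_on T f"
  shows "smooth_on S f"
  unfolding smooth_on_def
  by (rule allI, rule Ck_on_local) (use assms in \<open>force simp: smooth_on_def\<close>)

lemma smooth_on_subset: "smooth_on S f \<Longrightarrow> T \<subseteq> S \<Longrightarrow> smooth_on T f"
  unfolding smooth_on_def using Ck_on_subset by blast

lemma smooth_on_differentiable: "smooth_on S f \<Longrightarrow> y \<in> S \<Longrightarrow> f differentiable (at y)"
  unfolding smooth_on_def by (drule spec[of _ "Suc 0"]) simp

lemma smooth_on_frechet_derivative:
  assumes "smooth_on S f"
  shows "smooth_on S (\<lambda>y. frechet_derivative f (at y) v)"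
  unfolding smooth_on_def
proof
  fix k
  have "Ck_on (Suc k) S f" using assms unfolding smooth_on_def ..
  then show "Ck_on k S (\<lambda>y. frechet_derivative f (at y) v)" by simp
qed

lemma smooth_on_const: "open S \<Longrightarrow> smooth_on S (\<lambda>_. c)"
  by (simp add: smooth_on_def Ck_on_const)

lemma smooth_on_id: "open S \<Longrightarrow> smooth_on S (\<lambda>y. y)"
  by (simp add: smooth_on_def Ck_on_id)

lemma smooth_on_add: "open S \<Longrightarrow> smooth_on S f \<Longrightarrow> smooth_on S g \<Longrightarrow> smooth_on S (\<lambda>y. f y + g y)"
  by (simp add: smooth_on_def Ck_on_add)

lemma smooth_on_sum:
  "open S \<Longrightarrow> (\<And>i. i \<in> I \<Longrightarrow> smooth_on S (f i)) \<Longrightarrow> smooth_on S (\<lambda>y. \<Sum>i\<in>I. f i y)"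
  by (simp add: smooth_on_def Ck_on_sum)

lemma smooth_on_scaleR:
  fixes f :: "_ \<Rightarrow> real"
  shows "open S \<Longrightarrow> smooth_on S f \<Longrightarrow> smooth_on S g \<Longrightarrow> smooth_on S (\<lambda>y. f y *\<^sub>R g y)"
  by (simp add: smooth_on_def Ck_on_scaleR)

lemma smooth_on_inner_left: "open S \<Longrightarrow> smooth_on S f \<Longrightarrow> smooth_on S (\<lambda>y. f y \<bullet> b)"
  by (simp add: smooth_on_def Ck_on_bounded_linear[OF _ bounded_linear_inner_left])

lemma smooth_on_Pair:
  "open S \<Longrightarrow> smooth_on S f \<Longrightarrow> smooth_on S g \<Longrightarrow> smooth_on S (\<lambda>y. (f y, g y))"
  by (simp add: smooth_on_def Ck_on_Pair)

lemma smooth_on_compose: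
  assumes "orthonormal_basis (B :: 'b::real_inner set)" "open S" "open T"
    and "smooth_on S f" "smooth_on T (g :: 'b \<Rightarrow> _)" "f ` S \<subseteq> T"
  shows "smooth_on S (\<lambda>y. g (f y))"
  using assms unfolding smooth_on_def by (blast intro: Ck_on_compose)

section \<open>Smooth functions and tangent vectors on a manifold\<close>

lemma smooth_manifold_chart_exists:
  assumes "smooth_manifold \<A>"
  obtains C where "C \<in> \<A>" "x \<in> fst C"
proof -
  have "x \<in> (\<Union>C\<in>\<A>. fst C)" using assms by (simp add: smooth_manifold_def)
  then show ?thesis using that by blast
qed

lemma chart_inv_chart:
  assumes "smooth_manifold \<A>" "C \<in> \<A>" "x \<in> fst C"
  shows "chart_inv C (snd C x) = x"
  using assms by (auto simp: smooth_manifold_def homeomorphism_def)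

lemma open_chart_image:
  assumes "smooth_manifold \<A>" "C \<in> \<A>" "open U"
  shows "open (snd C ` (fst C \<inter> U))"
proof -
  have "homeomorphism (fst C) (snd C ` fst C) (snd C) (chart_inv C)" "open (snd C ` fst C)"
    using assms(1,2) by (auto simp: smooth_manifold_def)
  moreover have "openin (top_of_set (fst C)) (fst C \<inter> U)"
    using assms(3) by (rule openin_open_Int)
  ultimately show ?thesis
    using homeomorphism_imp_open_map openin_open_eq by blast
qed

lemma open_chart_domain: "smooth_manifold \<A> \<Longrightarrow> C \<in> \<A> \<Longrightarrow> open (fst C)"
  by (simp add: smooth_manifold_def)

lemma open_chart_range: "smooth_manifold \<A> \<Longrightarrow> C \<in> \<A> \<Longrightarrow> open (snd C ` fst C)"
  by (simp add: smooth_manifold_def)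

section \<open>The algebra of smooth functions\<close>

lemma msmooth_on_subset: "msmooth_on \<A> U f \<Longrightarrow> W \<subseteq> U \<Longrightarrow> msmooth_on \<A> W f"
  unfolding msmooth_on_def by (blast intro: smooth_on_subset)

lemma msmooth_on_cong:
  assumes "smooth_manifold \<A>" "open U" "\<And>x. x \<in> U \<Longrightarrow> f x = g x" "msmooth_on \<A> U f"
  shows "msmooth_on \<A> U g"
  unfolding msmooth_on_def
proof
  fix C assume C: "C \<in> \<A>"
  show "smooth_on (snd C ` (fst C \<inter> U)) (g \<circ> chart_inv C)"
  proof (rule smooth_on_cong[OF open_chart_image[OF assms(1) C assms(2)]])
    show "smooth_on (snd C ` (fst C \<inter> U)) (f \<circ> chart_inv C)"
      using assms(4) C by (simp add: msmooth_on_def)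
  qed (auto simp: chart_inv_chart[OF assms(1) C] assms(3))
qed

lemma msmooth_on_add:
  assumes "smooth_manifold \<A>" "open U" "msmooth_on \<A> U f" "msmooth_on \<A> U g"
  shows "msmooth_on \<A> U (\<lambda>x. f x + g x)"
  using assms smooth_on_add[OF open_chart_image[OF assms(1) _ assms(2)]]
  unfolding msmooth_on_def comp_def by blast

lemma msmooth_on_scaleR:
  fixes f :: "_ \<Rightarrow> real"
  assumes "smooth_manifold \<A>" "open U" "msmooth_on \<A> U f" "msmooth_on \<A> U g"
  shows "msmooth_on \<A> U (\<lambda>x. f x *\<^sub>R g x)"
  using assms smooth_on_scaleR[OF open_chart_image[OF assms(1) _ assms(2)]]
  unfolding msmooth_on_def comp_def by blast

lemma smooth_functions_chart:
  "f \<in> smooth_functions \<A> \<Longrightarrow> C \<in> \<A> \<Longrightarrow> smooth_on (snd C ` fst C) (f \<circ> chart_inv C)"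
  by (simp add: smooth_functions_def msmooth_on_def)

lemma smooth_functions_const:
  assumes "smooth_manifold \<A>"
  shows "(\<lambda>_. c) \<in> smooth_functions \<A>"
  using smooth_on_const[OF open_chart_range[OF assms]]
  by (auto simp: smooth_functions_def msmooth_on_def comp_def)

lemma smooth_functions_zero: "smooth_manifold \<A> \<Longrightarrow> 0 \<in> smooth_functions \<A>"
  unfolding zero_fun_def by (rule smooth_functions_const)

lemma smooth_functions_add:
  assumes "smooth_manifold \<A>" "f \<in> smooth_functions \<A>" "g \<in> smooth_functions \<A>"
  shows "f + g \<in> smooth_functions \<A>"
  using msmooth_on_add[OF assms(1) open_UNIV, of f g] assms(2,3)
  by (simp add: smooth_functions_def plus_fun_def)

lemma smooth_functions_mult:
  assumes "smooth_manifold \<A>" "f \<in> smooth_functions \<A>" "g \<in> smooth_functions \<A>"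
  shows "f * g \<in> smooth_functions \<A>"
  using msmooth_on_scaleR[OF assms(1) open_UNIV, of f g] assms(2,3)
  by (simp add: smooth_functions_def times_fun_def)

lemma smooth_functions_uminus:
  assumes "smooth_manifold \<A>" "f \<in> smooth_functions \<A>"
  shows "- f \<in> smooth_functions \<A>"
proof -
  have "- f = (\<lambda>_. -1) * f" by (simp add: fun_eq_iff)
  then show ?thesis
    using smooth_functions_mult[OF assms(1) smooth_functions_const assms(2)] assms(1) by simp
qed

lemma smooth_functions_diff:
  assumes "smooth_manifold \<A>" "f \<in> smooth_functions \<A>" "g \<in> smooth_functions \<A>"
  shows "f - g \<in> smooth_functions \<A>"
  using smooth_functions_add[OF assms(1,2) smooth_functions_uminus[OF assms(1,3)]] by simp

lemma smooth_functions_sum: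
  assumes "smooth_manifold \<A>" "\<And>i. i \<in> I \<Longrightarrow> f i \<in> smooth_functions \<A>"
  shows "(\<Sum>i\<in>I. f i) \<in> smooth_functions \<A>"
  using assms(2)
  by (induction I rule: infinite_finite_induct)
    (simp_all add: smooth_functions_zero smooth_functions_add assms(1))

section \<open>The differential of a smooth function\<close>

lemma smooth_function_has_derivative:
  assumes "smooth_manifold \<A>" "f \<in> smooth_functions \<A>" "C \<in> \<A>" "x \<in> fst C"
  shows "((f \<circ> chart_inv C) has_derivative frechet_derivative (f \<circ> chart_inv C) (at (snd C x)))
    (at (snd C x))"
  using smooth_on_differentiable[OF smooth_functions_chart[OF assms(2,3)]] assms(4)
  by (simp flip: frechet_derivative_works)

text \<open>Independence of the chart chosen by \<open>SOME\<close>: the chain rule for the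
  coordinate change \<tau> produces exactly the derivative that relates \<open>v C\<close> and
  \<open>v D\<close> in \<open>tangent_space\<close>.\<close>

lemma differential_chart:
  assumes man: "smooth_manifold \<A>" and f: "f \<in> smooth_functions \<A>"
    and C: "C \<in> \<A>" "x \<in> fst C" and v: "v \<in> tangent_space \<A> x"
  shows "differential \<A> f (x, v) = frechet_derivative (f \<circ> chart_inv C) (at (snd C x)) (v C)"
proof -
  define D where "D = (SOME D. D \<in> \<A> \<and> x \<in> fst D)"
  have "D \<in> \<A> \<and> x \<in> fst D"
    using C unfolding D_def by (intro someI[of "\<lambda>D. D \<in> \<A> \<and> x \<in> fst D"]) simp
  then have D: "D \<in> \<A>" "x \<in> fst D" by auto
  define \<tau> where "\<tau> = snd D \<circ> chart_inv C"
  have "smooth_on (snd C ` (fst C \<inter> fst D)) \<tau>"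
    using man C(1) D(1) unfolding \<tau>_def smooth_manifold_def by blast
  then have \<tau>: "(\<tau> has_derivative frechet_derivative \<tau> (at (snd C x))) (at (snd C x))"
    using C D smooth_on_differentiable[of _ \<tau> "snd C x"] by (simp flip: frechet_derivative_works)
  have \<tau>x: "\<tau> (snd C x) = snd D x"
    using chart_inv_chart[OF man C] by (simp add: \<tau>_def)
  have "((\<lambda>y. (f \<circ> chart_inv D) (\<tau> y)) has_derivative
      (\<lambda>u. frechet_derivative (f \<circ> chart_inv D) (at (snd D x)) (frechet_derivative \<tau> (at (snd C x)) u)))
      (at (snd C x))"
    using smooth_function_has_derivative[OF man f D]
    by (intro has_derivative_compose[OF \<tau>]) (simp only: \<tau>x)
  moreover have "(f \<circ> chart_inv D) (\<tau> y) = (f \<circ> chart_inv C) y" if "y \<in> snd C ` (fst C \<inter> fst D)" for y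
    using that by (auto simp: \<tau>_def chart_inv_chart[OF man C(1)] chart_inv_chart[OF man D(1)])
  moreover have "open (snd C ` (fst C \<inter> fst D))" "snd C x \<in> snd C ` (fst C \<inter> fst D)"
    using open_chart_image[OF man C(1) open_chart_domain[OF man D(1)]] C D by auto
  ultimately have "((f \<circ> chart_inv C) has_derivative
      (\<lambda>u. frechet_derivative (f \<circ> chart_inv D) (at (snd D x)) (frechet_derivative \<tau> (at (snd C x)) u)))
      (at (snd C x))"
    by (blast intro: has_derivative_transform_within_open)
  then have "frechet_derivative (f \<circ> chart_inv C) (at (snd C x)) =
      (\<lambda>u. frechet_derivative (f \<circ> chart_inv D) (at (snd D x)) (frechet_derivative \<tau> (at (snd C x)) u))"
    by (rule frechet_derivative_at[symmetric])
  moreover have "v D = frechet_derivative \<tau> (at (snd C x)) (v C)"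
    using v C D unfolding tangent_space_def \<tau>_def by blast
  moreover have "differential \<A> f (x, v) =
      frechet_derivative (f \<circ> chart_inv D) (at (snd D x)) (v D)"
    by (simp add: differential_def D_def Let_def)
  ultimately show ?thesis by simp
qed

text \<open>The chosen chart depends on the base point alone, so one chart serves all functions and
  vectors at \<open>x\<close>. The algebraic rules below thus hold for every pair
  \<open>(x, v)\<close>, tangent or not.\<close>

lemma differential_some_chart:
  assumes "smooth_manifold \<A>"
  obtains C where "C \<in> \<A>" "x \<in> fst C"
    "\<forall>f v. differential \<A> f (x, v) = frechet_derivative (f \<circ> chart_inv C) (at (snd C x)) (v C)"
proof -
  define C where "C = (SOME C. C \<in> \<A> \<and> x \<in> fst C)"
  have "C \<in> \<A> \<and> x \<in> fst C"
    using smooth_manifold_chart_exists[OF assms, of x] unfolding C_def by (metis (mono_tags, lifting) someI)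
  then show ?thesis by (intro that[of C]) (simp_all add: differential_def C_def Let_def)
qed

lemma differential_const: "differential \<A> (\<lambda>_. c) t = 0"
proof -
  have "frechet_derivative (\<lambda>_. c) (at y) = (\<lambda>_. 0)" for y :: 'b
    by (rule frechet_derivative_at[OF has_derivative_const, symmetric])
  then show ?thesis by (simp add: differential_def Let_def comp_def)
qed

lemma differential_add:
  assumes "smooth_manifold \<A>" "f \<in> smooth_functions \<A>" "g \<in> smooth_functions \<A>"
  shows "differential \<A> (f + g) t = differential \<A> f t + differential \<A> g t"
proof -
  obtain x v where t: "t = (x, v)" by fastforce
  obtain C where C: "C \<in> \<A>" "x \<in> fst C"
    "\<forall>f v. differential \<A> f (x, v) = frechet_derivative (f \<circ> chart_inv C) (at (snd C x)) (v C)"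
    using differential_some_chart[OF assms(1), of x] .
  have "(f + g) \<circ> chart_inv C = (\<lambda>y. (f \<circ> chart_inv C) y + (g \<circ> chart_inv C) y)"
    by (simp add: fun_eq_iff)
  then show ?thesis
    unfolding t C(3)[rule_format]
    using frechet_derivative_at[OF has_derivative_add[OF
        smooth_function_has_derivative[OF assms(1,2) C(1,2)]
        smooth_function_has_derivative[OF assms(1,3) C(1,2)]], symmetric] by simp
qed

lemma differential_mult:
  assumes "smooth_manifold \<A>" "f \<in> smooth_functions \<A>" "g \<in> smooth_functions \<A>"
  shows "differential \<A> (f * g) t = f (fst t) * differential \<A> g t + differential \<A> f t * g (fst t)"
proof -
  obtain x v where t: "t = (x, v)" by fastforce
  obtain C where C: "C \<in> \<A>" "x \<in> fst C"
    "\<forall>f v. differential \<A> f (x, v) = frechet_derivative (f \<circ> chart_inv C) (at (snd C x)) (v C)"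
    using differential_some_chart[OF assms(1), of x] .
  have "(f * g) \<circ> chart_inv C = (\<lambda>y. (f \<circ> chart_inv C) y * (g \<circ> chart_inv C) y)"
    by (simp add: fun_eq_iff)
  then show ?thesis
    unfolding t C(3)[rule_format]
    using frechet_derivative_at[OF has_derivative_mult[OF
        smooth_function_has_derivative[OF assms(1,2) C(1,2)]
        smooth_function_has_derivative[OF assms(1,3) C(1,2)]], symmetric]
    by (simp add: chart_inv_chart[OF assms(1) C(1,2)])
qed

lemma linear_differential:
  assumes "smooth_manifold \<A>" "f \<in> smooth_functions \<A>"
  shows "differential \<A> f (x, \<lambda>C. v C + w C) = differential \<A> f (x, v) + differential \<A> f (x, w)"
    and "differential \<A> f (x, \<lambda>C. r *\<^sub>R v C) = r * differential \<A> f (x, v)"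
proof -
  obtain C where C: "C \<in> \<A>" "x \<in> fst C"
    "\<forall>f v. differential \<A> f (x, v) = frechet_derivative (f \<circ> chart_inv C) (at (snd C x)) (v C)"
    using differential_some_chart[OF assms(1), of x] .
  have "linear (frechet_derivative (f \<circ> chart_inv C) (at (snd C x)))"
    using has_derivative_linear[OF smooth_function_has_derivative[OF assms C(1,2)]] .
  then show "differential \<A> f (x, \<lambda>C. v C + w C) = differential \<A> f (x, v) + differential \<A> f (x, w)"
    and "differential \<A> f (x, \<lambda>C. r *\<^sub>R v C) = r * differential \<A> f (x, v)"
    unfolding C(3)[rule_format] by (simp_all add: linear_add linear_cmul)
qed

section \<open>Sections, bracket and anchor of a Lie algebroid\<close>

text \<open>What a trivialisation leaves at a single point: an injective linear map on the fibre.
  Forgetting the neighbourhood suits the pointwise comparison of sections.\<close>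

definition fibre_coordinates ::
  "('e, 'm, 'v::real_vector) vbundle \<Rightarrow> 'm \<Rightarrow> ('e \<Rightarrow> 'v) \<Rightarrow> bool" where
  "fibre_coordinates B x \<phi> \<longleftrightarrow> inj_on \<phi> (fibre B x) \<and>
     (\<forall>u\<in>fibre B x. \<forall>v\<in>fibre B x. \<phi> (vb_add B u v) = \<phi> u + \<phi> v) \<and>
     (\<forall>r. \<forall>u\<in>fibre B x. \<phi> (vb_scale B r u) = r *\<^sub>R \<phi> u)"

lemma trivialisation_fibre_coordinates:
  assumes "smooth_vector_bundle \<A> B" "(U, \<phi>) \<in> vb_trivs B" "x \<in> U"
  shows "fibre_coordinates B x \<phi>"
  using assms unfolding smooth_vector_bundle_def fibre_coordinates_def
  by (fastforce intro: bij_betw_imp_inj_on)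

lemma trivialisation_open:
  "smooth_vector_bundle \<A> B \<Longrightarrow> (U, \<phi>) \<in> vb_trivs B \<Longrightarrow> open U"
  unfolding smooth_vector_bundle_def by fast

lemma trivialisation_exists:
  assumes "smooth_vector_bundle \<A> B"
  obtains U \<phi> where "(U, \<phi>) \<in> vb_trivs B" "x \<in> U"
proof -
  have "x \<in> (\<Union>(U, \<phi>)\<in>vb_trivs B. U)"
    using assms unfolding smooth_vector_bundle_def by simp
  then show ?thesis using that by auto
qed

lemma fibre_vector_space:
  "smooth_vector_bundle \<A> B \<Longrightarrow>
    is_real_vector_space (fibre B x) (vb_add B) (vb_zero B x) (vb_scale B)"
  by (simp add: smooth_vector_bundle_def)

lemma fibre_add:
  "smooth_vector_bundle \<A> B \<Longrightarrow> u \<in> fibre B x \<Longrightarrow> v \<in> fibre B x \<Longrightarrow> vb_add B u v \<in> fibre B x"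
  by (drule fibre_vector_space[where x=x]) (simp add: is_real_vector_space_def)

lemma fibre_scale:
  "smooth_vector_bundle \<A> B \<Longrightarrow> u \<in> fibre B x \<Longrightarrow> vb_scale B r u \<in> fibre B x"
  by (drule fibre_vector_space[where x=x]) (simp add: is_real_vector_space_def)

lemma fibre_zero: "smooth_vector_bundle \<A> B \<Longrightarrow> vb_zero B x \<in> fibre B x"
  by (drule fibre_vector_space[where x=x]) (simp add: is_real_vector_space_def)

lemma fibre_coordinates_zero:
  assumes "smooth_vector_bundle \<A> B" "fibre_coordinates B x \<phi>"
  shows "\<phi> (vb_zero B x) = 0"
proof -
  have "vb_add B (vb_zero B x) (vb_zero B x) = vb_zero B x"
    using fibre_vector_space[OF assms(1), of x] by (simp add: is_real_vector_space_def)
  then have "\<phi> (vb_zero B x) + \<phi> (vb_zero B x) = \<phi> (vb_zero B x)"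
    using assms(2) fibre_zero[OF assms(1)] by (metis fibre_coordinates_def)
  then show ?thesis by simp
qed

lemma eq_by_fibre_coordinates:
  assumes "smooth_vector_bundle \<A> B" "\<And>x. s x \<in> fibre B x" "\<And>x. t x \<in> fibre B x"
    and "\<And>x \<phi>. fibre_coordinates B x \<phi> \<Longrightarrow> \<phi> (s x) = \<phi> (t x)"
  shows "s = t"
proof
  fix x
  obtain U \<phi> where "(U, \<phi>) \<in> vb_trivs B" "x \<in> U"
    using trivialisation_exists[OF assms(1), of x] .
  then have "fibre_coordinates B x \<phi>" by (rule trivialisation_fibre_coordinates[OF assms(1)])
  then show "s x = t x"
    using assms(2,3)[of x] assms(4)[of x \<phi>] unfolding fibre_coordinates_def inj_on_def by blast
qed

lemma sections_fibre: "s \<in> sections \<A> B \<Longrightarrow> s x \<in> fibre B x"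
  by (simp add: sections_def)

lemma coordinates_sec_add:
  "fibre_coordinates B x \<phi> \<Longrightarrow> s \<in> sections \<A> B \<Longrightarrow> t \<in> sections \<A> B \<Longrightarrow>
    \<phi> (sec_add B s t x) = \<phi> (s x) + \<phi> (t x)"
  by (simp add: fibre_coordinates_def sec_add_def sections_fibre)

lemma coordinates_sec_scale:
  "fibre_coordinates B x \<phi> \<Longrightarrow> s \<in> sections \<A> B \<Longrightarrow>
    \<phi> (sec_scale B f s x) = f x *\<^sub>R \<phi> (s x)"
  by (simp add: fibre_coordinates_def sec_scale_def sections_fibre)

lemma sec_add_sections:
  assumes "smooth_manifold \<A>" "smooth_vector_bundle \<A> B" "s \<in> sections \<A> B" "t \<in> sections \<A> B"
  shows "sec_add B s t \<in> sections \<A> B"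
proof -
  have "msmooth_on \<A> U (\<lambda>x. \<phi> (sec_add B s t x))" if U: "(U, \<phi>) \<in> vb_trivs B" for U \<phi>
  proof -
    have "msmooth_on \<A> U (\<lambda>x. \<phi> (s x) + \<phi> (t x))"
      using U assms(3,4)
      by (intro msmooth_on_add assms trivialisation_open[OF assms(2) U]) (auto simp: sections_def)
    moreover have "\<phi> (s x) + \<phi> (t x) = \<phi> (sec_add B s t x)" if "x \<in> U" for x
      by (rule coordinates_sec_add[symmetric, OF trivialisation_fibre_coordinates[OF assms(2) U that] assms(3,4)])
    ultimately show ?thesis
      by (rule msmooth_on_cong[OF assms(1) trivialisation_open[OF assms(2) U], rotated])
  qed
  then show ?thesis
    using assms fibre_add by (fastforce simp: sections_def sec_add_def)
qed

lemma sec_scale_sections: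
  assumes "smooth_manifold \<A>" "smooth_vector_bundle \<A> B"
    and "f \<in> smooth_functions \<A>" "s \<in> sections \<A> B"
  shows "sec_scale B f s \<in> sections \<A> B"
proof -
  have "msmooth_on \<A> U (\<lambda>x. \<phi> (sec_scale B f s x))" if U: "(U, \<phi>) \<in> vb_trivs B" for U \<phi>
  proof -
    have "msmooth_on \<A> U (\<lambda>x. f x *\<^sub>R \<phi> (s x))"
      using U assms(3,4)
      by (intro msmooth_on_scaleR assms trivialisation_open[OF assms(2) U])
        (auto simp: sections_def smooth_functions_def intro: msmooth_on_subset)
    moreover have "f x *\<^sub>R \<phi> (s x) = \<phi> (sec_scale B f s x)" if "x \<in> U" for x
      by (rule coordinates_sec_scale[symmetric, OF trivialisation_fibre_coordinates[OF assms(2) U that] assms(4)])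
    ultimately show ?thesis
      by (rule msmooth_on_cong[OF assms(1) trivialisation_open[OF assms(2) U], rotated])
  qed
  then show ?thesis
    using assms fibre_scale by (fastforce simp: sections_def sec_scale_def)
qed

section \<open>Bracket identities and the Lie derivative of functions\<close>

context lie_algebroid
begin

abbreviation sects :: "('m \<Rightarrow> 'e) set" where "sects \<equiv> sections \<A> E"

abbreviation lie :: "('m \<Rightarrow> 'e) \<Rightarrow> ('m \<Rightarrow> real) \<Rightarrow> 'm \<Rightarrow> real" where
  "lie s f \<equiv> lie_fun \<A> (\<rho> \<circ> s) f"

lemmas smooth_const = smooth_functions_const[OF base]
lemmas sec_closed = br_closed sec_add_sections[OF base vbundle] sec_scale_sections[OF base vbundle]
lemmas coordinates_simps = coordinates_sec_add[where \<A>=\<A>] coordinates_sec_scale[where \<A>=\<A>]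
  fibre_coordinates_zero[OF vbundle]

lemma section_eqI:
  assumes "s \<in> sects" "t \<in> sects" "\<And>x \<phi>. fibre_coordinates E x \<phi> \<Longrightarrow> \<phi> (s x) = \<phi> (t x)"
  shows "s = t"
  using assms by (intro eq_by_fibre_coordinates[OF vbundle]) (auto intro: sections_fibre)

text \<open>Polarisation: expand the bracket of s + t with itself and cancel the two alternating
  terms.\<close>

lemma br_skew:
  assumes "s \<in> sects" "t \<in> sects"
  shows "br s t = sec_scale E (\<lambda>_. -1) (br t s)"
proof (rule section_eqI)
  fix x \<phi> assume \<phi>: "fibre_coordinates E x \<phi>"
  have "\<phi> (br (sec_add E s t) (sec_add E s t) x) = 0"
    using br_alternating[of "sec_add E s t"] \<phi> assms by (simp add: sec_closed coordinates_simps)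
  moreover have "\<phi> (br s s x) = 0" "\<phi> (br t t x) = 0"
    using br_alternating \<phi> assms by (simp_all add: coordinates_simps)
  ultimately have "\<phi> (br s t x) + \<phi> (br t s x) = 0"
    using assms \<phi> by (simp add: br_add_left br_add_right sec_closed coordinates_simps add.commute)
  then show "\<phi> (br s t x) = \<phi> (sec_scale E (\<lambda>_. -1) (br t s) x)"
    using assms \<phi> by (simp add: sec_closed coordinates_simps add_eq_0_iff2)
qed (use assms in \<open>simp_all add: sec_closed smooth_const\<close>)

text \<open>The Jacobi identity, rearranged by skew-symmetry into the statement that
  \<open>br\<close> sends brackets to commutators. This is the form that matches a commutator of Lie
  derivatives.\<close>

lemma br_br_left:
  assumes "s \<in> sects" "t \<in> sects" "u \<in> sects"
  shows "br (br s t) u = sec_add E (br s (br t u)) (sec_scale E (\<lambda>_. -1) (br t (br s u)))"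
proof (rule section_eqI)
  fix x \<phi> assume \<phi>: "fibre_coordinates E x \<phi>"
  have "\<phi> (br s (br t u) x) + (\<phi> (br t (br u s) x) + \<phi> (br u (br s t) x)) = 0"
    using arg_cong[OF jacobi[OF assms], of "\<lambda>w. \<phi> (w x)"] \<phi> assms
    by (simp add: sec_closed coordinates_simps)
  moreover have "\<phi> (br u (br s t) x) = - \<phi> (br (br s t) u x)"
    using br_skew[of u "br s t"] \<phi> assms by (simp add: sec_closed coordinates_simps)
  moreover have "br t (br u s) = sec_scale E (\<lambda>_. -1) (br t (br s u))"
    using br_skew[of u s] br_scale_right assms by (simp add: sec_closed)
  ultimately show "\<phi> (br (br s t) u x) =
      \<phi> (sec_add E (br s (br t u)) (sec_scale E (\<lambda>_. -1) (br t (br s u))) x)"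
    using \<phi> assms by (simp add: sec_closed coordinates_simps smooth_const algebra_simps)
qed (use assms in \<open>simp_all add: sec_closed smooth_const\<close>)

lemma anchor_tangent:
  assumes "s \<in> sects"
  shows "fst (\<rho> (s x)) = x" "snd (\<rho> (s x)) \<in> tangent_space \<A> x"
proof -
  have "\<rho> (s x) \<in> fibre (tangent_bundle \<A>) x"
    using anchor sections_fibre[OF assms] unfolding vector_bundle_map_def by blast
  then show "fst (\<rho> (s x)) = x" "snd (\<rho> (s x)) \<in> tangent_space \<A> x"
    by (auto simp: fibre_def tangent_bundle_def)
qed

lemma lie_apply: "s \<in> sects \<Longrightarrow> lie s f x = differential \<A> f (x, snd (\<rho> (s x)))"
  using anchor_tangent(1)[of s x] by (simp add: lie_fun_def) (metis prod.collapse)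

lemma lie_const: "lie s (\<lambda>_. c) = 0"
  by (simp add: lie_fun_def differential_const fun_eq_iff)

lemma lie_add: "f \<in> smooth_functions \<A> \<Longrightarrow> g \<in> smooth_functions \<A> \<Longrightarrow> lie s (f + g) = lie s f + lie s g"
  by (simp add: lie_fun_def differential_add[OF base] fun_eq_iff)

lemma lie_mult:
  "s \<in> sects \<Longrightarrow> f \<in> smooth_functions \<A> \<Longrightarrow> g \<in> smooth_functions \<A> \<Longrightarrow>
    lie s (f * g) = f * lie s g + lie s f * g"
  by (simp add: lie_fun_def differential_mult[OF base] anchor_tangent fun_eq_iff)

lemma lie_cmult:
  assumes "s \<in> sects" "f \<in> smooth_functions \<A>"
  shows "lie s (\<lambda>x. c * f x) = (\<lambda>x. c * lie s f x)"
  using lie_mult[OF assms(1) smooth_const[of c] assms(2)]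
  by (simp add: lie_const times_fun_def plus_fun_def)

lemma lie_uminus:
  assumes "s \<in> sects" "f \<in> smooth_functions \<A>"
  shows "lie s (- f) = - lie s f"
  using lie_cmult[OF assms, of "-1"] by (simp add: fun_Compl_def)

lemma lie_diff:
  assumes "s \<in> sects" "f \<in> smooth_functions \<A>" "g \<in> smooth_functions \<A>"
  shows "lie s (f - g) = lie s f - lie s g"
  using lie_add[OF assms(2) smooth_functions_uminus[OF base assms(3)], of s] lie_uminus[OF assms(1,3)]
  by simp

lemma lie_sum:
  "(\<And>i. i \<in> I \<Longrightarrow> f i \<in> smooth_functions \<A>) \<Longrightarrow> lie s (\<Sum>i\<in>I. f i) = (\<Sum>i\<in>I. lie s (f i))"
  by (induction I rule: infinite_finite_induct)
    (simp_all add: lie_fun_zero lie_add smooth_functions_sum[OF base])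

lemma lie_sec_scale:
  assumes "s \<in> sects" "f \<in> smooth_functions \<A>" "g \<in> smooth_functions \<A>"
  shows "lie (sec_scale E f s) g = f * lie s g"
proof
  fix x
  have "\<rho> (vb_scale E (f x) (s x)) = vb_scale (tangent_bundle \<A>) (f x) (\<rho> (s x))"
    using anchor sections_fibre[OF assms(1)] unfolding vector_bundle_map_def by blast
  then have "\<rho> (sec_scale E f s x) = (x, \<lambda>C. f x *\<^sub>R snd (\<rho> (s x)) C)"
    using anchor_tangent(1)[OF assms(1), of x]
    by (simp add: sec_scale_def tangent_bundle_def case_prod_beta)
  then show "lie (sec_scale E f s) g x = (f * lie s g) x"
    using assms by (simp add: lie_apply sec_closed linear_differential[OF base])
qed

lemma lie_smooth:
  assumes s: "s \<in> sects" and f: "f \<in> smooth_functions \<A>"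
  shows "lie s f \<in> smooth_functions \<A>"
proof -
  have "smooth_on (snd C ` fst C) (lie s f \<circ> chart_inv C)" if C: "C \<in> \<A>" for C
  proof (rule smooth_on_local)
    fix y assume "y \<in> snd C ` fst C"
    then obtain x where x: "x \<in> fst C" "y = snd C x" by blast
    obtain U \<phi> where U: "(U, \<phi>) \<in> vb_trivs E" "x \<in> U"
      using trivialisation_exists[OF vbundle, of x] .
    have oU: "open U" using trivialisation_open[OF vbundle U(1)] .
    define T where "T = snd C ` (fst C \<inter> U)"
    have T: "open T" "y \<in> T"
      using open_chart_image[OF base C oU] x U(2) by (auto simp: T_def)
    have fin: "finite_dimensional TYPE('a)" "finite_dimensional TYPE('v)"
      using base vbundle by (simp_all add: smooth_manifold_def smooth_vector_bundle_def)
    obtain B :: "'a set" where B: "orthonormal_basis B"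
      using finite_dimensional_orthonormal_basis[OF fin(1)] .
    obtain B' :: "'v set" where B': "orthonormal_basis B'"
      using finite_dimensional_orthonormal_basis[OF fin(2)] .
    \<comment> \<open>\<open>G\<close> is the anchor in local coordinates: \<phi> on
      \<open>E\<close> and \<open>C\<close> on the tangent bundle, where each chart is itself a
      trivialisation. \<open>X\<close>, the coordinate form of the vector field, is \<open>G\<close>
      after the map sending \<open>z\<close> to the pair of \<open>z\<close> and the coordinates of
      \<open>s\<close> there.\<close>
    define G where "G = (\<lambda>(z, v). snd (\<rho> (inv_into (fibre E (chart_inv C z)) \<phi> v)) C)"
    define X where "X = (\<lambda>z. snd (\<rho> (s (chart_inv C z))) C)"
    have "(fst C, \<lambda>(x, v). v C) \<in> vb_trivs (tangent_bundle \<A>)"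
      using C by (simp add: tangent_bundle_def)
    then have "smooth_fibre_map_on \<A> (U \<inter> fst C)
        (\<lambda>x v. (\<lambda>(x, v). v C) (\<rho> (inv_into (fibre E x) \<phi> v)))"
      using anchor U(1) by (auto simp only: vector_bundle_map_def dest!: bspec)
    then have "smooth_on (snd C ` (fst C \<inter> (U \<inter> fst C)) \<times> UNIV) G"
      using C by (simp add: smooth_fibre_map_on_def G_def case_prod_beta)
    then have G: "smooth_on (T \<times> UNIV) G"
      by (simp add: T_def Int_absorb2 Int_commute Int_left_commute)
    have "smooth_on T (\<lambda>z. (z, \<phi> (s (chart_inv C z))))"
      using s U(1) C
      by (intro smooth_on_Pair smooth_on_id T)
        (auto simp: sections_def msmooth_on_def comp_def T_def)
    then have "smooth_on T (\<lambda>z. G (z, \<phi> (s (chart_inv C z))))"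
      by (rule smooth_on_compose[OF orthonormal_basis_Times[OF B B'] T(1)
            open_Times[OF T(1) open_UNIV] _ G]) auto
    moreover have "G (z, \<phi> (s (chart_inv C z))) = X z" if "z \<in> T" for z
    proof -
      have "chart_inv C z \<in> U" using that chart_inv_chart[OF base C] by (auto simp: T_def)
      then have "inj_on \<phi> (fibre E (chart_inv C z))"
        using trivialisation_fibre_coordinates[OF vbundle U(1)] by (simp add: fibre_coordinates_def)
      then show ?thesis
        by (simp add: G_def X_def sections_fibre[OF s])
    qed
    ultimately have X: "smooth_on T X"
      by (rule smooth_on_cong[OF T(1), rotated])
    have F: "smooth_on T (f \<circ> chart_inv C)"
      using smooth_functions_chart[OF f C] by (rule smooth_on_subset) (auto simp: T_def)
    \<comment> \<open>The derivative of \<open>f\<close> in the direction \<open>X z\<close> is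
      spread over the fixed directions \<open>b\<close>, because
      \<open>smooth_on_frechet_derivative\<close> applies to a constant direction.\<close>
    have "smooth_on T (\<lambda>z. \<Sum>b\<in>B. (X z \<bullet> b) *\<^sub>R frechet_derivative (f \<circ> chart_inv C) (at z) b)"
      by (rule smooth_on_sum[OF T(1) smooth_on_scaleR[OF T(1) smooth_on_inner_left[OF T(1) X]
              smooth_on_frechet_derivative[OF F]]])
    moreover have "(\<Sum>b\<in>B. (X z \<bullet> b) *\<^sub>R frechet_derivative (f \<circ> chart_inv C) (at z) b) =
        (lie s f \<circ> chart_inv C) z" if z: "z \<in> T" for z
    proof -
      have "(\<Sum>b\<in>B. (X z \<bullet> b) *\<^sub>R frechet_derivative (f \<circ> chart_inv C) (at z) b) =
          frechet_derivative (f \<circ> chart_inv C) (at z) (X z)"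
        by (rule linear_orthonormal_basis[OF B linear_frechet_derivative[OF
                smooth_on_differentiable[OF F z]], symmetric])
      moreover obtain x' where "x' \<in> fst C" "z = snd C x'" using z by (auto simp: T_def)
      ultimately show ?thesis
        using lie_apply[OF s, of f x'] differential_chart[OF base f C _ anchor_tangent(2)[OF s], of x']
        by (simp add: X_def chart_inv_chart[OF base C])
    qed
    ultimately have "smooth_on T (lie s f \<circ> chart_inv C)"
      by (rule smooth_on_cong[OF T(1), rotated])
    with T show "\<exists>T. open T \<and> y \<in> T \<and> smooth_on T (lie s f \<circ> chart_inv C)" by blast
  qed
  then show ?thesis by (simp add: smooth_functions_def msmooth_on_def)
qed

text \<open>The Leibniz rule carried to the left slot by skew-symmetry. The function is now
  differentiated along the other section \<open>t\<close>, and with a minus sign.\<close>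

lemma br_scale_fun_left:
  assumes "s \<in> sects" "t \<in> sects" "f \<in> smooth_functions \<A>"
  shows "br (sec_scale E f s) t = sec_add E (sec_scale E f (br s t)) (sec_scale E (- lie t f) s)"
proof (rule section_eqI)
  fix x \<phi> assume \<phi>: "fibre_coordinates E x \<phi>"
  have "br (sec_scale E f s) t = sec_scale E (\<lambda>_. -1)
      (sec_add E (sec_scale E f (br t s)) (sec_scale E (lie t f) s))"
    using assms br_skew[of "sec_scale E f s" t] by (simp add: sec_closed leibniz)
  moreover have "\<phi> (br t s x) = - \<phi> (br s t x)"
    using br_skew[of t s] \<phi> assms by (simp add: sec_closed coordinates_simps)
  ultimately show "\<phi> (br (sec_scale E f s) t x) =
      \<phi> (sec_add E (sec_scale E f (br s t)) (sec_scale E (- lie t f) s) x)"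
    using \<phi> assms by (simp add: sec_closed coordinates_simps lie_smooth smooth_functions_uminus[OF base])
qed (use assms in \<open>simp_all add: sec_closed smooth_const lie_smooth smooth_functions_uminus[OF base]\<close>)

text \<open>
  Comparing the coefficients of \<open>U\<close> in \<open>{{s, t}, f U}\<close> proves the claim wherever some section \<open>U\<close>
  does not vanish. At a point where all sections vanish, both sides are zero, so no bump functions
  are required.
\<close>

lemma lie_br:
  assumes s: "s \<in> sects" and t: "t \<in> sects" and f: "f \<in> smooth_functions \<A>"
  shows "lie (br s t) f = lie s (lie t f) - lie t (lie s f)"
proof
  fix x
  obtain V \<phi> where "(V, \<phi>) \<in> vb_trivs E" "x \<in> V"
    using trivialisation_exists[OF vbundle, of x] .
  then have \<phi>: "fibre_coordinates E x \<phi>" by (rule trivialisation_fibre_coordinates[OF vbundle])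
  note closed = sec_closed lie_smooth smooth_const s t f
  show "lie (br s t) f x = (lie s (lie t f) - lie t (lie s f)) x"
  proof (cases "\<exists>U\<in>sects. \<phi> (U x) \<noteq> 0")
    case True
    then obtain U where U: "U \<in> sects" "\<phi> (U x) \<noteq> 0" by blast
    \<comment> \<open>The first-order terms are symmetric under exchanging \<open>a\<close> and
      \<open>b\<close>, so the commutator keeps only the second-order term and the term without
      derivatives of \<open>f\<close>.\<close>
    have twice: "\<phi> (br a (br b (sec_scale E f U)) x) = f x *\<^sub>R \<phi> (br a (br b U) x) +
        lie a f x *\<^sub>R \<phi> (br b U x) + lie b f x *\<^sub>R \<phi> (br a U x) + lie a (lie b f) x *\<^sub>R \<phi> (U x)"
      if "a \<in> sects" "b \<in> sects" for a b
      using that \<phi> U(1) by (simp add: closed leibniz br_add_right coordinates_simps)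
    have "\<phi> (br (br s t) (sec_scale E f U) x) =
        f x *\<^sub>R \<phi> (br (br s t) U x) + lie (br s t) f x *\<^sub>R \<phi> (U x)"
      using \<phi> U(1) by (simp add: closed leibniz coordinates_simps)
    moreover have "\<phi> (br (br s t) (sec_scale E f U) x) =
        f x *\<^sub>R \<phi> (br (br s t) U x) + (lie s (lie t f) x - lie t (lie s f) x) *\<^sub>R \<phi> (U x)"
      using \<phi> U(1) by (simp add: closed br_br_left coordinates_simps twice algebra_simps)
    ultimately show ?thesis using U(2) by simp
  next
    case False
    \<comment> \<open>At \<open>x\<close> the section \<open>a\<close> agrees with its multiple by
      the constant function 0, and \<open>lie\<close> is function-linear in the section.\<close>
    have "lie a g x = 0" if a: "a \<in> sects" and g: "g \<in> smooth_functions \<A>" for a g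
    proof -
      have "\<phi> (sec_scale E (\<lambda>_. 0) a x) = \<phi> (a x)"
        using False a \<phi> by (simp add: closed coordinates_simps)
      then have "sec_scale E (\<lambda>_. 0) a x = a x"
        using \<phi> sections_fibre[OF a] sections_fibre[of "sec_scale E (\<lambda>_. 0) a" \<A> E x] a
        unfolding fibre_coordinates_def inj_on_def by (simp add: closed)
      then have "lie a g x = lie (sec_scale E (\<lambda>_. 0) a) g x"
        by (simp add: lie_fun_def)
      also have "\<dots> = 0" using lie_sec_scale[OF a smooth_const[of 0] g] by simp
      finally show ?thesis .
    qed
    then show ?thesis by (simp add: closed)
  qed
qed

end

section \<open>Forms\<close>

lemma sum_fun_apply: "(\<Sum>i\<in>I. f i) x = (\<Sum>i\<in>I. f i x)"
  by (induction I rule: infinite_finite_induct) simp_all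

text \<open>
  The conditions of \<^const>\<open>forms_deg\<close> imposed in all degrees at once. This contains the direct sum
  \<^const>\<open>forms\<close>, so inhomogeneous forms need not be decomposed.
\<close>

definition alt_forms ::
  "('m, 'a::real_inner) chart set \<Rightarrow> ('e, 'm, 'v::real_inner) vbundle \<Rightarrow> ('m, 'e) form set" where
  "alt_forms \<A> E =
     {\<eta>. (\<forall>Vs. \<not> set Vs \<subseteq> sections \<A> E \<longrightarrow> \<eta> Vs = 0) \<and>
         (\<forall>Vs. set Vs \<subseteq> sections \<A> E \<longrightarrow>
            \<eta> Vs \<in> smooth_functions \<A> \<and>
            (\<forall>i<length Vs. \<forall>s\<in>sections \<A> E. \<forall>t\<in>sections \<A> E.
               \<eta> (Vs[i := sec_add E s t]) = \<eta> (Vs[i := s]) + \<eta> (Vs[i := t])) \<and>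
            (\<forall>i<length Vs. \<forall>f\<in>smooth_functions \<A>. \<forall>s\<in>sections \<A> E.
               \<eta> (Vs[i := sec_scale E f s]) = f * \<eta> (Vs[i := s])) \<and>
            (\<forall>i<length Vs. \<forall>j<length Vs. i \<noteq> j \<and> Vs ! i = Vs ! j \<longrightarrow> \<eta> Vs = 0))}"

text \<open>In the other degrees all values are 0 and the conditions become trivial;
  \<open>smooth_manifold\<close> enters through the smoothness of the zero function.\<close>

lemma forms_deg_iff:
  assumes "smooth_manifold \<A>"
  shows "\<eta> \<in> forms_deg \<A> E p \<longleftrightarrow> \<eta> \<in> alt_forms \<A> E \<and> (\<forall>Vs. length Vs \<noteq> p \<longrightarrow> \<eta> Vs = 0)"
proof
  assume L: "\<eta> \<in> forms_deg \<A> E p"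
  then have len: "\<eta> Vs = 0" if "length Vs \<noteq> p" for Vs
    using that by (simp add: forms_deg_def)
  have "\<eta> \<in> alt_forms \<A> E"
    unfolding alt_forms_def
  proof (rule CollectI, rule conjI, goal_cases)
    case 1
    then show ?case using L by (simp add: forms_deg_def)
  next
    case 2
    show ?case
    proof (intro allI impI)
      fix Vs assume "set Vs \<subseteq> sections \<A> E"
      then show "\<eta> Vs \<in> smooth_functions \<A> \<and>
            (\<forall>i<length Vs. \<forall>s\<in>sections \<A> E. \<forall>t\<in>sections \<A> E.
               \<eta> (Vs[i := sec_add E s t]) = \<eta> (Vs[i := s]) + \<eta> (Vs[i := t])) \<and>
            (\<forall>i<length Vs. \<forall>f\<in>smooth_functions \<A>. \<forall>s\<in>sections \<A> E.
               \<eta> (Vs[i := sec_scale E f s]) = f * \<eta> (Vs[i := s])) \<and>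
            (\<forall>i<length Vs. \<forall>j<length Vs. i \<noteq> j \<and> Vs ! i = Vs ! j \<longrightarrow> \<eta> Vs = 0)"
        using L unfolding forms_deg_def
        by (cases "length Vs = p") (auto simp: len smooth_functions_zero[OF assms])
    qed
  qed
  with len show "\<eta> \<in> alt_forms \<A> E \<and> (\<forall>Vs. length Vs \<noteq> p \<longrightarrow> \<eta> Vs = 0)" by blast
qed (auto simp: forms_deg_def alt_forms_def)

lemma alt_forms_add:
  assumes "smooth_manifold \<A>" "\<eta> \<in> alt_forms \<A> E" "\<zeta> \<in> alt_forms \<A> E"
  shows "\<eta> + \<zeta> \<in> alt_forms \<A> E"
  using assms(2,3) unfolding alt_forms_def
  by (simp add: smooth_functions_add[OF assms(1)] algebra_simps)

lemma alt_forms_sum: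
  assumes "smooth_manifold \<A>" "\<And>i. i \<in> I \<Longrightarrow> \<omega> i \<in> alt_forms \<A> E"
  shows "(\<Sum>i\<in>I. \<omega> i) \<in> alt_forms \<A> E"
proof -
  have "0 \<in> alt_forms \<A> E" by (simp add: alt_forms_def smooth_functions_zero[OF assms(1)])
  then show ?thesis
    using assms(2)
    by (induction I rule: infinite_finite_induct) (simp_all add: alt_forms_add[OF assms(1)])
qed

lemma forms_alt_forms: "smooth_manifold \<A> \<Longrightarrow> \<eta> \<in> forms \<A> E \<Longrightarrow> \<eta> \<in> alt_forms \<A> E"
  by (auto simp: forms_def forms_deg_iff intro!: alt_forms_sum)

lemma alt_forms_off: "\<eta> \<in> alt_forms \<A> E \<Longrightarrow> \<not> set Vs \<subseteq> sections \<A> E \<Longrightarrow> \<eta> Vs = 0"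
  by (simp add: alt_forms_def)

lemma alt_forms_smooth:
  "\<eta> \<in> alt_forms \<A> E \<Longrightarrow> set Vs \<subseteq> sections \<A> E \<Longrightarrow> \<eta> Vs \<in> smooth_functions \<A>"
  by (simp add: alt_forms_def)

lemma alt_forms_sec_add:
  "\<eta> \<in> alt_forms \<A> E \<Longrightarrow> set Vs \<subseteq> sections \<A> E \<Longrightarrow> i < length Vs \<Longrightarrow>
    s \<in> sections \<A> E \<Longrightarrow> t \<in> sections \<A> E \<Longrightarrow>
    \<eta> (Vs[i := sec_add E s t]) = \<eta> (Vs[i := s]) + \<eta> (Vs[i := t])"
  by (simp add: alt_forms_def)

lemma alt_forms_sec_scale:
  "\<eta> \<in> alt_forms \<A> E \<Longrightarrow> set Vs \<subseteq> sections \<A> E \<Longrightarrow> i < length Vs \<Longrightarrow>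
    f \<in> smooth_functions \<A> \<Longrightarrow> s \<in> sections \<A> E \<Longrightarrow>
    \<eta> (Vs[i := sec_scale E f s]) = f * \<eta> (Vs[i := s])"
  by (simp add: alt_forms_def)

lemma alt_forms_alternating:
  "\<eta> \<in> alt_forms \<A> E \<Longrightarrow> set Vs \<subseteq> sections \<A> E \<Longrightarrow> i < length Vs \<Longrightarrow> j < length Vs \<Longrightarrow>
    i \<noteq> j \<Longrightarrow> Vs ! i = Vs ! j \<Longrightarrow> \<eta> Vs = 0"
  unfolding alt_forms_def by blast

lemma list_update_sections:
  "set Vs \<subseteq> S \<Longrightarrow> s \<in> S \<Longrightarrow> set (Vs[i := s]) \<subseteq> S"
  using set_update_subset_insert[of Vs i s] by blast

lemma nth_sections: "set Vs \<subseteq> S \<Longrightarrow> i < length Vs \<Longrightarrow> Vs ! i \<in> S"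
  using nth_mem by blast

text \<open>Suppressing the point turns each summand into a product of functions, with the sign as a
  constant function, so that the rules for \<open>lie\<close> apply.\<close>

lemma wedge_conv_sum:
  "wedge \<xi> \<eta> Vs = (\<Sum>p\<le>length Vs. \<Sum>\<sigma>\<in>shuffles_perm p (length Vs - p).
     (\<lambda>_. of_int (sign \<sigma>)) * (\<xi> (map (\<lambda>i. Vs ! \<sigma> i) [0..<p]) *
       \<eta> (map (\<lambda>i. Vs ! \<sigma> i) [p..<length Vs])))"
  by (simp add: wedge_def fun_eq_iff sum_fun_apply mult.assoc)

section \<open>The Lie derivative of alternating forms\<close>

context lie_algebroid
begin

abbreviation Lform :: "('m \<Rightarrow> 'e) \<Rightarrow> ('m, 'e) form \<Rightarrow> ('m, 'e) form" where
  "Lform \<equiv> lie_form \<A> E br \<rho>"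

lemmas form_closed = sec_closed nth_sections list_update_sections

text \<open>Alternation is assumed as vanishing on repeated arguments; inserting s + t in both slots
  and expanding yields the sign change.\<close>

lemma alt_forms_swap:
  assumes \<eta>: "\<eta> \<in> alt_forms \<A> E" and Vs: "set Vs \<subseteq> sects" and ij: "i < length Vs" "j < length Vs" "i \<noteq> j"
    and s: "s \<in> sects" "t \<in> sects"
  shows "\<eta> (Vs[i := s, j := t]) = - \<eta> (Vs[i := t, j := s])"
proof -
  have same: "\<eta> (Vs[i := u, j := u]) = 0" if "u \<in> sects" for u
    using that ij by (intro alt_forms_alternating[OF \<eta>, of _ i j]) (simp_all add: form_closed Vs)
  have "\<eta> (Vs[i := sec_add E s t, j := u]) = \<eta> (Vs[i := s, j := u]) + \<eta> (Vs[i := t, j := u])"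
    if "u \<in> sects" for u
    using that ij s
    by (subst (1 2 3) list_update_swap) (simp_all add: alt_forms_sec_add[OF \<eta>] form_closed Vs)
  then have "\<eta> (Vs[i := sec_add E s t, j := sec_add E s t]) =
      \<eta> (Vs[i := s, j := t]) + \<eta> (Vs[i := t, j := s])"
    using ij s by (simp add: alt_forms_sec_add[OF \<eta>] form_closed Vs same)
  then show ?thesis
    using same[of "sec_add E s t"] s by (simp add: form_closed add_eq_0_iff2)
qed

lemma Lform_off: "\<not> set Vs \<subseteq> sects \<Longrightarrow> Lform V \<eta> Vs = 0"
  by (simp add: lie_form_def)

lemma Lform_on:
  "set Vs \<subseteq> sects \<Longrightarrow>
    Lform V \<eta> Vs = lie V (\<eta> Vs) - (\<Sum>i<length Vs. \<eta> (Vs[i := br V (Vs ! i)]))"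
  by (simp add: lie_form_def)

text \<open>For function-linearity, the Leibniz rule in slot \<open>i\<close> creates the extra term
  \<open>lie V f * \<eta> (Vs[i := s])\<close>, which cancels against the one from the product rule
  for \<open>lie V\<close>. For alternation, let the entries at \<open>i\<close> and
  \<open>j\<close> agree: summands altering another slot vanish, and the remaining two are
  opposite.\<close>

lemma Lform_alt_forms:
  assumes V: "V \<in> sects" and \<eta>: "\<eta> \<in> alt_forms \<A> E"
  shows "Lform V \<eta> \<in> alt_forms \<A> E"
  unfolding alt_forms_def
proof (intro CollectI conjI allI impI ballI)
  fix Vs assume Vs: "set Vs \<subseteq> sects"
  show "Lform V \<eta> Vs \<in> smooth_functions \<A>"
    unfolding Lform_on[OF Vs]
    by (intro smooth_functions_diff smooth_functions_sum base lie_smooth V alt_forms_smooth[OF \<eta>] Vs)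
      (simp add: form_closed V Vs)
  fix i assume i: "i < length Vs"
  show "Lform V \<eta> (Vs[i := sec_add E s t]) = Lform V \<eta> (Vs[i := s]) + Lform V \<eta> (Vs[i := t])"
    if st: "s \<in> sects" "t \<in> sects" for s t
  proof -
    have "\<eta> (Vs[i := sec_add E s t, k := br V (Vs[i := sec_add E s t] ! k)]) =
        \<eta> (Vs[i := s, k := br V (Vs[i := s] ! k)]) + \<eta> (Vs[i := t, k := br V (Vs[i := t] ! k)])"
      if k: "k < length Vs" for k
    proof (cases "k = i")
      case True
      then show ?thesis
        using i st by (simp add: br_add_right alt_forms_sec_add[OF \<eta>] form_closed V Vs)
    next
      case False
      then show ?thesis
        using i k st
        by (simp add: list_update_swap[of i k] alt_forms_sec_add[OF \<eta>] form_closed V Vs)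
    qed
    then show ?thesis
      using i st
      by (simp add: Lform_on form_closed V Vs alt_forms_sec_add[OF \<eta>] lie_add alt_forms_smooth[OF \<eta>]
          sum.distrib)
  qed
  show "Lform V \<eta> (Vs[i := sec_scale E f s]) = f * Lform V \<eta> (Vs[i := s])"
    if f: "f \<in> smooth_functions \<A>" and s: "s \<in> sects" for f s
  proof -
    have "\<eta> (Vs[i := sec_scale E f s, k := br V (Vs[i := sec_scale E f s] ! k)]) =
        f * \<eta> (Vs[i := s, k := br V (Vs[i := s] ! k)]) +
        (if k = i then lie V f * \<eta> (Vs[i := s]) else 0)"
      if k: "k < length Vs" for k
    proof (cases "k = i")
      case True
      then show ?thesis
        using i s f
        by (simp add: leibniz alt_forms_sec_add[OF \<eta>] alt_forms_sec_scale[OF \<eta>] form_closed V Vs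
            lie_smooth)
    next
      case False
      then show ?thesis
        using i k s f
        by (simp add: list_update_swap[of i k] alt_forms_sec_scale[OF \<eta>] form_closed V Vs)
    qed
    then have "(\<Sum>k<length Vs. \<eta> (Vs[i := sec_scale E f s, k := br V (Vs[i := sec_scale E f s] ! k)])) =
        f * (\<Sum>k<length Vs. \<eta> (Vs[i := s, k := br V (Vs[i := s] ! k)])) + lie V f * \<eta> (Vs[i := s])"
      using i by (simp add: sum.distrib sum_distrib_left)
    moreover have "lie V (\<eta> (Vs[i := sec_scale E f s])) =
        f * lie V (\<eta> (Vs[i := s])) + lie V f * \<eta> (Vs[i := s])"
      using i s f
      by (simp add: alt_forms_sec_scale[OF \<eta>] Vs lie_mult V alt_forms_smooth[OF \<eta>] form_closed)
    ultimately show ?thesis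
      using i s f by (simp add: Lform_on form_closed V Vs algebra_simps)
  qed
  fix j assume j: "j < length Vs" and ij: "i \<noteq> j \<and> Vs ! i = Vs ! j"
  have "(\<Sum>k<length Vs. \<eta> (Vs[k := br V (Vs ! k)])) = (\<Sum>k\<in>{i, j}. \<eta> (Vs[k := br V (Vs ! k)]))"
  proof (rule sum.mono_neutral_right)
    show "\<forall>k\<in>{..<length Vs} - {i, j}. \<eta> (Vs[k := br V (Vs ! k)]) = 0"
      using i j ij
      by (intro ballI alt_forms_alternating[OF \<eta>, of _ i j]) (simp_all add: form_closed V Vs)
  qed (use i j in auto)
  also have "\<dots> = \<eta> (Vs[i := br V (Vs ! i), j := Vs ! i]) + \<eta> (Vs[i := Vs ! i, j := br V (Vs ! i)])"
  \<comment> \<open>Redundant updates give both lists the two-slot shape required by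
    \<open>alt_forms_swap\<close>.\<close>
  proof -
    have "Vs[i := br V (Vs ! i), j := Vs ! i] = Vs[i := br V (Vs ! i)]"
      "Vs[i := Vs ! i, j := br V (Vs ! i)] = Vs[j := br V (Vs ! j)]"
      using ij by (metis list_update_id list_update_swap)+
    then show ?thesis using ij by (simp only:) simp
  qed
  also have "\<dots> = 0"
    by (subst alt_forms_swap[OF \<eta> Vs i j]) (use ij i j in \<open>auto simp: form_closed V Vs\<close>)
  finally show "Lform V \<eta> Vs = 0"
    using alt_forms_alternating[OF \<eta> Vs i j] ij by (simp add: Lform_on Vs lie_fun_zero)
qed (rule Lform_off)

lemma Lform_forms_deg:
  assumes "V \<in> sects" "\<eta> \<in> forms_deg \<A> E p"
  shows "Lform V \<eta> \<in> forms_deg \<A> E p"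
proof -
  have \<eta>: "\<eta> \<in> alt_forms \<A> E" "\<And>Vs. length Vs \<noteq> p \<Longrightarrow> \<eta> Vs = 0"
    using assms(2) forms_deg_iff[OF base] by blast+
  have "Lform V \<eta> Vs = 0" if "length Vs \<noteq> p" for Vs
    using that by (simp add: lie_form_def \<eta>(2) lie_fun_zero)
  with Lform_alt_forms[OF assms(1) \<eta>(1)] show ?thesis by (simp add: forms_deg_iff[OF base])
qed

text \<open>On a single section W both sides compare \<L>(V) \<L>(W) f - \<L>({V, W}) f with \<L>(W)
  \<L>(V) f, which is \<open>lie_br\<close>. On all other lists both sides vanish.\<close>

lemma Lform_d_rho:
  assumes V: "V \<in> sects" and f: "f \<in> smooth_functions \<A>"
  shows "Lform V (d_rho \<A> E \<rho> f) = d_rho \<A> E \<rho> (lie V f)"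
proof
  fix Vs
  have single: "d_rho \<A> E \<rho> g [W] = lie W g" if "W \<in> sects" for g W
    using that by (simp add: d_rho_def lie_fun_def comp_def)
  show "Lform V (d_rho \<A> E \<rho> f) Vs = d_rho \<A> E \<rho> (lie V f) Vs"
  proof (cases "length Vs = 1 \<and> set Vs \<subseteq> sects")
    case True
    then obtain W where W: "Vs = [W]" "W \<in> sects" by (auto simp: length_Suc_conv)
    then show ?thesis
      using lie_br[OF V W(2) f] by (simp add: Lform_on single V form_closed)
  next
    case False
    then have "d_rho \<A> E \<rho> g Ws = 0" if "length Ws = length Vs" "set Vs \<subseteq> sects" for g Ws
      using that by (simp add: d_rho_def)
    then show ?thesis
      using False by (cases "set Vs \<subseteq> sects") (auto simp: Lform_on Lform_off lie_fun_zero d_rho_def)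
  qed
qed

text \<open>Evaluate on \<open>W # Vs\<close>: the summand of index 0 brackets \<open>V\<close> with
  \<open>W\<close> and gives the left side; all other terms occur in both Lie derivatives and
  cancel.\<close>

lemma int_prod_br:
  assumes V: "V \<in> sects" and W: "W \<in> sects" and \<eta>: "\<eta> \<in> alt_forms \<A> E"
  shows "int_prod (br V W) \<eta> = Lform V (int_prod W \<eta>) - int_prod W (Lform V \<eta>)"
proof
  fix Vs
  show "int_prod (br V W) \<eta> Vs = (Lform V (int_prod W \<eta>) - int_prod W (Lform V \<eta>)) Vs"
  proof (cases "set Vs \<subseteq> sects")
    case True
    then show ?thesis
      by (simp add: int_prod_def Lform_on W sum.lessThan_Suc_shift del: sum.lessThan_Suc)
  next
    case False
    then show ?thesis by (simp add: int_prod_def Lform_off alt_forms_off[OF \<eta>])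
  qed
qed

lemma Lform_add:
  assumes "V \<in> sects" "\<eta> \<in> alt_forms \<A> E" "\<zeta> \<in> alt_forms \<A> E"
  shows "Lform V (\<eta> + \<zeta>) = Lform V \<eta> + Lform V \<zeta>"
  using assms
  by (auto simp: fun_eq_iff lie_form_def lie_add alt_forms_smooth[of _ \<A> E] sum.distrib)

lemma Lform_cmult:
  assumes V: "V \<in> sects" and \<eta>: "\<eta> \<in> alt_forms \<A> E"
  shows "Lform V (\<lambda>Vs x. r * \<eta> Vs x) = (\<lambda>Vs x. r * Lform V \<eta> Vs x)"
proof
  fix Vs
  show "Lform V (\<lambda>Vs x. r * \<eta> Vs x) Vs = (\<lambda>x. r * Lform V \<eta> Vs x)"
    using lie_cmult[OF V alt_forms_smooth[OF \<eta>], of Vs r]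
    by (auto simp: lie_form_def fun_eq_iff sum_fun_apply right_diff_distrib sum_distrib_left)
qed

text \<open>In the commutator, terms that differentiate once and bracket once cancel. So do double
  brackets in two different slots, which commute. Left over are the functions, handled by
  \<open>lie_br\<close>, and the double brackets within one slot, handled by the Jacobi
  identity.\<close>

lemma Lform_br:
  assumes V: "V \<in> sects" and W: "W \<in> sects" and \<eta>: "\<eta> \<in> alt_forms \<A> E"
  shows "Lform (br V W) \<eta> = Lform V (Lform W \<eta>) - Lform W (Lform V \<eta>)"
proof
  fix Vs
  show "Lform (br V W) \<eta> Vs = (Lform V (Lform W \<eta>) - Lform W (Lform V \<eta>)) Vs"
  proof (cases "set Vs \<subseteq> sects")
    case Vs: True
    let ?n = "length Vs"
    \<comment> \<open>\<open>F V W i j\<close> brackets slot \<open>i\<close> with \<open>V\<close>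
      and then slot \<open>j\<close> of the result with \<open>W\<close>. For \<open>i = j\<close>
      the brackets are nested with \<open>W\<close> outermost, which accounts for the minus sign in
      \<open>diag\<close>.\<close>
    define F where "F = (\<lambda>V W i j. \<eta> (Vs[i := br V (Vs ! i), j := br W (Vs[i := br V (Vs ! i)] ! j)]))"
    have twice: "Lform V (Lform W \<eta>) Vs = lie V (lie W (\<eta> Vs)) -
        (\<Sum>i<?n. lie V (\<eta> (Vs[i := br W (Vs ! i)]))) - (\<Sum>i<?n. lie W (\<eta> (Vs[i := br V (Vs ! i)]))) +
        (\<Sum>i<?n. \<Sum>j<?n. F V W i j)" if V: "V \<in> sects" and W: "W \<in> sects" for V W
    proof -
      have smooth: "\<eta> (Vs[i := br W (Vs ! i)]) \<in> smooth_functions \<A>" if "i < ?n" for i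
        using that by (intro alt_forms_smooth[OF \<eta>]) (simp add: form_closed W Vs)
      have "lie V (Lform W \<eta> Vs) = lie V (lie W (\<eta> Vs)) - (\<Sum>i<?n. lie V (\<eta> (Vs[i := br W (Vs ! i)])))"
        unfolding Lform_on[OF Vs] using smooth
        by (subst lie_diff[OF V lie_smooth[OF W alt_forms_smooth[OF \<eta> Vs]]], simp_all)
          (auto intro!: lie_sum smooth_functions_sum[OF base])
      moreover have "(\<Sum>i<?n. Lform W \<eta> (Vs[i := br V (Vs ! i)])) =
          (\<Sum>i<?n. lie W (\<eta> (Vs[i := br V (Vs ! i)]))) - (\<Sum>i<?n. \<Sum>j<?n. F V W i j)"
        by (simp add: Lform_on form_closed V Vs F_def flip: sum_subtractf)
      ultimately show ?thesis by (simp add: Lform_on[OF Vs])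
    qed
    have off: "F V W i j = F W V j i" if "i < ?n" "j < ?n" "i \<noteq> j" for i j
      using that by (simp add: F_def list_update_swap[of i j])
    have diag: "F V W i i - F W V i i = - \<eta> (Vs[i := br (br V W) (Vs ! i)])" if "i < ?n" for i
      using that
      by (simp add: F_def br_br_left V W form_closed Vs alt_forms_sec_add[OF \<eta>]
          alt_forms_sec_scale[OF \<eta>] smooth_const) (simp add: fun_eq_iff)
    \<comment> \<open>Interchanging the sums of the second term pairs (i, j) with (j, i), so that
      \<open>off\<close> annihilates everything except the diagonal.\<close>
    have "(\<Sum>i<?n. \<Sum>j<?n. F V W i j) - (\<Sum>i<?n. \<Sum>j<?n. F W V i j) =
        (\<Sum>i<?n. \<Sum>j<?n. F V W i j - F W V j i)"
      by (subst (2) sum.swap) (simp add: sum_subtractf)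
    also have "\<dots> = (\<Sum>i<?n. \<Sum>j<?n. if i = j then - \<eta> (Vs[i := br (br V W) (Vs ! i)]) else 0)"
      using off diag by (intro sum.cong) auto
    also have "\<dots> = - (\<Sum>i<?n. \<eta> (Vs[i := br (br V W) (Vs ! i)]))"
      by (simp add: sum_negf)
    finally show ?thesis
      using lie_br[OF V W alt_forms_smooth[OF \<eta> Vs]]
      by (simp add: twice V W Lform_on[OF Vs, of "br V W"] algebra_simps)
  qed (simp add: Lform_off)
qed

end

section \<open>The wedge product and the Lie derivative\<close>

lemma shuffles_perm_permutes: "\<sigma> \<in> shuffles_perm p q \<Longrightarrow> \<sigma> permutes {..<p + q}"
  by (simp add: shuffles_perm_def)

context lie_algebroid
begin

text \<open>The identity holds for each pair of a degree \<open>p\<close> and a shuffle \<sigma>.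
  Bracketing one entry of \<open>Vs\<close> changes exactly one argument of exactly one factor;
  after relabelling the entries by \<sigma>, the correction sum splits into those of the two
  factors, and the product rule for \<open>lie V\<close> does the rest.\<close>

lemma Lform_wedge:
  assumes V: "V \<in> sects" and \<eta>: "\<eta> \<in> alt_forms \<A> E" and \<zeta>: "\<zeta> \<in> alt_forms \<A> E"
  shows "Lform V (wedge \<eta> \<zeta>) = wedge (Lform V \<eta>) \<zeta> + wedge \<eta> (Lform V \<zeta>)"
proof
  fix Vs :: "('m \<Rightarrow> 'e) list"
  let ?n = "length Vs"
  define A where "A = (\<lambda>Vs \<sigma> p. map (\<lambda>i. Vs ! \<sigma> i) [0..<p] :: ('m \<Rightarrow> 'e) list)"
  define B where "B = (\<lambda>Vs \<sigma> p. map (\<lambda>i. Vs ! \<sigma> i) [p..<length Vs] :: ('m \<Rightarrow> 'e) list)"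
  \<comment> \<open>Stated for all lists as long as \<open>Vs\<close>, so that \<open>Vs\<close> and
    its updates are summed over the same index sets and sums can be interchanged.\<close>
  have wedge_AB: "wedge \<xi> \<xi>' Ws = (\<Sum>p\<le>?n. \<Sum>\<sigma>\<in>shuffles_perm p (?n - p).
      (\<lambda>_. of_int (sign \<sigma>)) * (\<xi> (A Ws \<sigma> p) * \<xi>' (B Ws \<sigma> p)))"
    if "length Ws = ?n" for \<xi> \<xi>' :: "('m, 'e) form" and Ws
    unfolding wedge_conv_sum A_def B_def that ..
  have perm: "\<sigma> permutes {..<?n}" if "p \<le> ?n" "\<sigma> \<in> shuffles_perm p (?n - p)" for \<sigma> p
    using shuffles_perm_permutes[OF that(2)] that(1) by simp
  \<comment> \<open>If some entry of \<open>Vs\<close> is not a section, it becomes an argument of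
    one of the factors, which then vanishes.\<close>
  have set_AB: "set (A Vs \<sigma> p) \<union> set (B Vs \<sigma> p) = set Vs"
    if p: "p \<le> ?n" and \<sigma>: "\<sigma> \<in> shuffles_perm p (?n - p)" for \<sigma> p
  proof -
    have "set (A Vs \<sigma> p) \<union> set (B Vs \<sigma> p) = (\<lambda>i. Vs ! \<sigma> i) ` ({0..<p} \<union> {p..<?n})"
      by (auto simp: A_def B_def)
    also have "{0..<p} \<union> {p..<?n} = {..<?n}" using p by auto
    also have "(\<lambda>i. Vs ! \<sigma> i) ` {..<?n} = (!) Vs ` (\<sigma> ` {..<?n})" by (simp add: image_image)
    also have "\<dots> = set Vs"
      using permutes_image[OF perm[OF p \<sigma>]] by (simp add: set_conv_nth lessThan_def image_def) blast
    finally show ?thesis .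
  qed
  show "Lform V (wedge \<eta> \<zeta>) Vs = (wedge (Lform V \<eta>) \<zeta> + wedge \<eta> (Lform V \<zeta>)) Vs"
  proof (cases "set Vs \<subseteq> sects")
    case False
    have "Lform V \<eta> (A Vs \<sigma> p) * \<zeta> (B Vs \<sigma> p) = 0 \<and> \<eta> (A Vs \<sigma> p) * Lform V \<zeta> (B Vs \<sigma> p) = 0"
      if "p \<le> ?n" "\<sigma> \<in> shuffles_perm p (?n - p)" for \<sigma> p
    proof -
      have "\<not> set (A Vs \<sigma> p) \<subseteq> sects \<or> \<not> set (B Vs \<sigma> p) \<subseteq> sects"
        using set_AB[OF that] False by blast
      then show ?thesis
        by (elim disjE) (simp_all only: alt_forms_off[OF \<eta>] alt_forms_off[OF \<zeta>] Lform_off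
            mult_zero_left mult_zero_right simp_thms)
    qed
    then show ?thesis using False by (simp add: Lform_off wedge_AB)
  next
    case Vs: True
    have summand: "lie V ((\<lambda>_. of_int (sign \<sigma>)) * (\<eta> (A Vs \<sigma> p) * \<zeta> (B Vs \<sigma> p))) -
        (\<Sum>i<?n. (\<lambda>_. of_int (sign \<sigma>)) * (\<eta> (A (Vs[i := br V (Vs ! i)]) \<sigma> p) *
          \<zeta> (B (Vs[i := br V (Vs ! i)]) \<sigma> p))) =
        (\<lambda>_. of_int (sign \<sigma>)) * (Lform V \<eta> (A Vs \<sigma> p) * \<zeta> (B Vs \<sigma> p)) +
        (\<lambda>_. of_int (sign \<sigma>)) * (\<eta> (A Vs \<sigma> p) * Lform V \<zeta> (B Vs \<sigma> p))"
      and smooth: "(\<lambda>_. of_int (sign \<sigma>)) * (\<eta> (A Vs \<sigma> p) * \<zeta> (B Vs \<sigma> p)) \<in> smooth_functions \<A>"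
      if p: "p \<le> ?n" and \<sigma>: "\<sigma> \<in> shuffles_perm p (?n - p)" for \<sigma> p
    proof -
      have AB: "set (A Vs \<sigma> p) \<subseteq> sects" "set (B Vs \<sigma> p) \<subseteq> sects"
        using set_AB[OF p \<sigma>] Vs by auto
      note smooth = alt_forms_smooth[OF \<eta> AB(1)] alt_forms_smooth[OF \<zeta> AB(2)]
      show "(\<lambda>_. of_int (sign \<sigma>)) * (\<eta> (A Vs \<sigma> p) * \<zeta> (B Vs \<sigma> p)) \<in> smooth_functions \<A>"
        by (intro smooth_functions_mult base smooth_const smooth)
      note perm = perm[OF p \<sigma>]
      have inj: "\<sigma> i = \<sigma> j \<longleftrightarrow> i = j" for i j
        using permutes_inj[OF perm] by (auto dest: injD)
      have less: "\<sigma> i < ?n" if "i < ?n" for i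
        using permutes_in_image[OF perm, of i] that by simp
      define G where "G = (\<lambda>i. \<eta> (A (Vs[i := br V (Vs ! i)]) \<sigma> p) * \<zeta> (B (Vs[i := br V (Vs ! i)]) \<sigma> p))"
      \<comment> \<open>Position \<open>\<sigma> k\<close> of \<open>Vs\<close> is read by slot
        \<open>k\<close> of the first factor and, as \<sigma> is injective, by no other
        slot.\<close>
      have left: "G (\<sigma> k) = \<eta> ((A Vs \<sigma> p)[k := br V (A Vs \<sigma> p ! k)]) * \<zeta> (B Vs \<sigma> p)" if "k < p" for k
      proof -
        have "A (Vs[\<sigma> k := br V (Vs ! \<sigma> k)]) \<sigma> p = (A Vs \<sigma> p)[k := br V (A Vs \<sigma> p ! k)]"
          using that p by (intro nth_equalityI) (auto simp: A_def nth_list_update inj less)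
        moreover have "B (Vs[\<sigma> k := br V (Vs ! \<sigma> k)]) \<sigma> p = B Vs \<sigma> p"
          using that p by (intro nth_equalityI) (auto simp: B_def nth_list_update inj less)
        ultimately show ?thesis by (simp add: G_def)
      qed
      \<comment> \<open>\<open>B\<close> starts at index \<open>p\<close>, so position
        \<open>\<sigma> (p + k)\<close> of \<open>Vs\<close> is its slot \<open>k\<close>.\<close>
      have right: "G (\<sigma> (p + k)) = \<eta> (A Vs \<sigma> p) * \<zeta> ((B Vs \<sigma> p)[k := br V (B Vs \<sigma> p ! k)])"
        if "k < ?n - p" for k
      proof -
        have "A (Vs[\<sigma> (p + k) := br V (Vs ! \<sigma> (p + k))]) \<sigma> p = A Vs \<sigma> p"
          using that p by (intro nth_equalityI) (auto simp: A_def nth_list_update inj less)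
        moreover have "B (Vs[\<sigma> (p + k) := br V (Vs ! \<sigma> (p + k))]) \<sigma> p =
            (B Vs \<sigma> p)[k := br V (B Vs \<sigma> p ! k)]"
          using that p by (intro nth_equalityI) (auto simp: B_def nth_list_update inj less)
        ultimately show ?thesis by (simp add: G_def)
      qed
      have split: "(\<Sum>k<p + m. G (\<sigma> k)) = (\<Sum>k<p. G (\<sigma> k)) + (\<Sum>k<m. G (\<sigma> (p + k)))" for m
        by (induction m) (simp_all add: add.assoc)
      have "(\<Sum>i<?n. G i) = (\<Sum>k<?n. G (\<sigma> k))"
        by (rule sum.permute[OF perm, unfolded comp_def])
      also have "\<dots> = (\<Sum>k<p + (?n - p). G (\<sigma> k))" using p by simp
      also have "\<dots> = (\<Sum>k<p. G (\<sigma> k)) + (\<Sum>k<?n - p. G (\<sigma> (p + k)))"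
        by (rule split)
      also have "\<dots> = (\<Sum>k<length (A Vs \<sigma> p). \<eta> ((A Vs \<sigma> p)[k := br V (A Vs \<sigma> p ! k)])) * \<zeta> (B Vs \<sigma> p) +
          \<eta> (A Vs \<sigma> p) * (\<Sum>k<length (B Vs \<sigma> p). \<zeta> ((B Vs \<sigma> p)[k := br V (B Vs \<sigma> p ! k)]))"
        by (simp add: left right sum_distrib_left sum_distrib_right) (simp add: A_def B_def)
      finally have G: "(\<Sum>i<?n. G i) = \<dots>" .
      have "lie V ((\<lambda>_. of_int (sign \<sigma>)) * (\<eta> (A Vs \<sigma> p) * \<zeta> (B Vs \<sigma> p))) =
          (\<lambda>_. of_int (sign \<sigma>)) * (\<eta> (A Vs \<sigma> p) * lie V (\<zeta> (B Vs \<sigma> p)) +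
            lie V (\<eta> (A Vs \<sigma> p)) * \<zeta> (B Vs \<sigma> p))"
        by (simp add: lie_mult[OF V] smooth smooth_functions_mult[OF base] smooth_const lie_const)
      then show "lie V ((\<lambda>_. of_int (sign \<sigma>)) * (\<eta> (A Vs \<sigma> p) * \<zeta> (B Vs \<sigma> p))) -
        (\<Sum>i<?n. (\<lambda>_. of_int (sign \<sigma>)) * (\<eta> (A (Vs[i := br V (Vs ! i)]) \<sigma> p) *
          \<zeta> (B (Vs[i := br V (Vs ! i)]) \<sigma> p))) =
        (\<lambda>_. of_int (sign \<sigma>)) * (Lform V \<eta> (A Vs \<sigma> p) * \<zeta> (B Vs \<sigma> p)) +
        (\<lambda>_. of_int (sign \<sigma>)) * (\<eta> (A Vs \<sigma> p) * Lform V \<zeta> (B Vs \<sigma> p))"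
        using G by (simp add: Lform_on AB G_def algebra_simps flip: sum_distrib_left)
    qed
    have "(\<Sum>i<?n. wedge \<eta> \<zeta> (Vs[i := br V (Vs ! i)])) =
        (\<Sum>p\<le>?n. \<Sum>\<sigma>\<in>shuffles_perm p (?n - p). \<Sum>i<?n.
          (\<lambda>_. of_int (sign \<sigma>)) * (\<eta> (A (Vs[i := br V (Vs ! i)]) \<sigma> p) *
            \<zeta> (B (Vs[i := br V (Vs ! i)]) \<sigma> p)))"
      by (simp add: wedge_AB sum.swap[of _ _ "{..<?n}"])
    moreover have "lie V (wedge \<eta> \<zeta> Vs) = (\<Sum>p\<le>?n. \<Sum>\<sigma>\<in>shuffles_perm p (?n - p).
        lie V ((\<lambda>_. of_int (sign \<sigma>)) * (\<eta> (A Vs \<sigma> p) * \<zeta> (B Vs \<sigma> p))))"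
      unfolding wedge_AB[OF refl]
      by (subst lie_sum) (auto intro!: sum.cong lie_sum smooth_functions_sum[OF base] smooth)
    ultimately have "Lform V (wedge \<eta> \<zeta>) Vs = (\<Sum>p\<le>?n. \<Sum>\<sigma>\<in>shuffles_perm p (?n - p).
        lie V ((\<lambda>_. of_int (sign \<sigma>)) * (\<eta> (A Vs \<sigma> p) * \<zeta> (B Vs \<sigma> p))) -
        (\<Sum>i<?n. (\<lambda>_. of_int (sign \<sigma>)) * (\<eta> (A (Vs[i := br V (Vs ! i)]) \<sigma> p) *
          \<zeta> (B (Vs[i := br V (Vs ! i)]) \<sigma> p))))"
      by (simp add: Lform_on[OF Vs] sum_subtractf)
    also have "\<dots> = wedge (Lform V \<eta>) \<zeta> Vs + wedge \<eta> (Lform V \<zeta>) Vs"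
      by (simp add: summand wedge_AB sum.distrib)
    finally show ?thesis by simp
  qed
qed

end

text \<open>A \<open>(1, q)\<close>-shuffle is a cycle moving one index \<open>k\<close> to the front.\<close>

definition front_cycle :: "nat \<Rightarrow> nat \<Rightarrow> nat" where
  "front_cycle k i = (if i = 0 then k else if i \<le> k then i - 1 else i)"

text \<open>One adjacent transposition per step: both the permutation property and the sign follow
  by induction on \<open>k\<close>.\<close>

lemma front_cycle_Suc: "front_cycle (Suc k) = Transposition.transpose k (Suc k) \<circ> front_cycle k"
  by (auto simp: front_cycle_def fun_eq_iff Transposition.transpose_def)

lemma front_cycle_0: "front_cycle 0 = id"
  by (auto simp: front_cycle_def)

lemma front_cycle_permutes: "k \<le> q \<Longrightarrow> front_cycle k permutes {..<Suc q}"
proof (induction k)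
  case (Suc k)
  then show ?case
    unfolding front_cycle_Suc by (intro permutes_compose permutes_swap_id) auto
qed (simp add: front_cycle_0 permutes_id)

lemma sign_front_cycle: "sign (front_cycle k) = (-1) ^ k"
proof (induction k)
  case (Suc k)
  have "permutation (front_cycle k)"
    using front_cycle_permutes[OF order.refl] by (auto simp: permutation_permutes)
  then show ?case
    using Suc unfolding front_cycle_Suc
    by (subst sign_compose) (simp_all add: permutation_swap_id sign_swap_id)
qed (simp add: front_cycle_0)

text \<open>A (1,q)-shuffle is determined by its value \<open>k\<close> at 0: its remaining values
  enumerate the complement of \<open>k\<close> increasingly, and a sorted distinct list is
  determined by its set.\<close>

lemma shuffles_perm_1: "shuffles_perm 1 q = front_cycle ` {..q}"
proof (intro equalityI subsetI)
  fix \<sigma> assume "\<sigma> \<in> shuffles_perm 1 q"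
  then have \<sigma>: "\<sigma> permutes {..<Suc q}" "strict_mono_on {1..<Suc q} \<sigma>"
    by (simp_all add: shuffles_perm_def)
  define k where "k = \<sigma> 0"
  have k: "k \<le> q" using permutes_in_image[OF \<sigma>(1), of 0] by (simp add: k_def)
  have c: "front_cycle k permutes {..<Suc q}" by (rule front_cycle_permutes[OF k])
  have mono_c: "strict_mono_on {1..<Suc q} (front_cycle k)"
    by (auto simp: front_cycle_def strict_mono_on_def)
  have image: "\<tau> ` {1..<Suc q} = {..<Suc q} - {k}"
    if "\<tau> permutes {..<Suc q}" "\<tau> 0 = k" for \<tau>
  proof -
    have "{1..<Suc q} = {..<Suc q} - {0}" by auto
    then have "\<tau> ` {1..<Suc q} = \<tau> ` {..<Suc q} - \<tau> ` {0}"
      using image_set_diff[OF permutes_inj[OF that(1)]] by metis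
    then show ?thesis using permutes_image[OF that(1)] that(2) by simp
  qed
  have sorted: "sorted (map \<tau> [1..<Suc q]) \<and> distinct (map \<tau> [1..<Suc q])"
    if "strict_mono_on {1..<Suc q} \<tau>" for \<tau> :: "nat \<Rightarrow> nat"
    using that strict_mono_on_imp_inj_on[OF that]
    by (auto simp: sorted_map distinct_map sorted_wrt_iff_nth_less strict_mono_on_def
        intro!: less_imp_le simp del: upt_Suc)
  have "map \<sigma> [1..<Suc q] = map (front_cycle k) [1..<Suc q]"
    using sorted[OF \<sigma>(2)] sorted[OF mono_c] image[OF \<sigma>(1)] image[OF c]
    by (intro sorted_distinct_set_unique) (simp_all add: k_def front_cycle_def del: upt_Suc)
  then have on: "\<sigma> i = front_cycle k i" if "1 \<le> i" "i < Suc q" for i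
    using that by (simp add: map_eq_conv del: upt_Suc)
  have "\<sigma> = front_cycle k"
  proof
    fix i
    consider "i = 0" | "1 \<le> i" "i < Suc q" | "i \<ge> Suc q" by linarith
    then show "\<sigma> i = front_cycle k i"
      using on permutes_not_in[OF \<sigma>(1), of i] permutes_not_in[OF c, of i]
      by cases (auto simp: k_def front_cycle_def)
  qed
  then show "\<sigma> \<in> front_cycle ` {..q}" using k by blast
next
  fix \<sigma> assume "\<sigma> \<in> front_cycle ` {..q}"
  then show "\<sigma> \<in> shuffles_perm 1 q"
    by (auto simp: shuffles_perm_def front_cycle_permutes strict_mono_on_def)
      (auto simp: front_cycle_def)
qed

lemma sum_shuffles_perm_1: "(\<Sum>\<sigma>\<in>shuffles_perm 1 q. g \<sigma>) = (\<Sum>k\<le>q. g (front_cycle k))"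
proof -
  have "inj_on front_cycle {..q}"
    by (rule inj_onI) (metis front_cycle_def)
  then show ?thesis by (simp only: shuffles_perm_1 sum.reindex comp_def)
qed

lemma map_front_cycle:
  assumes "k < length Vs"
  shows "map (\<lambda>i. Vs ! front_cycle k i) [1..<length Vs] = take k Vs @ drop (Suc k) Vs"
  using assms by (intro nth_equalityI) (auto simp: front_cycle_def nth_append)

section \<open>The wedge of a differential with an interior product\<close>

context lie_algebroid
begin

lemma alt_forms_adjacent_swap:
  assumes \<eta>: "\<eta> \<in> alt_forms \<A> E" and "set (As @ a # b # Bs) \<subseteq> sects"
  shows "\<eta> (As @ a # b # Bs) = - \<eta> (As @ b # a # Bs)"
  using alt_forms_swap[OF \<eta> assms(2), of "length As" "Suc (length As)" a b] assms(2)
  by (simp add: list_update_append)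

text \<open>Each entry of \<open>Xs\<close> that \<open>a\<close> passes costs one sign; a passed
  entry joins \<open>As\<close>, which is therefore generalised in the induction.\<close>

lemma alt_forms_move_front:
  assumes \<eta>: "\<eta> \<in> alt_forms \<A> E" and "set (As @ a # Xs @ Bs) \<subseteq> sects"
  shows "\<eta> (As @ a # Xs @ Bs) x = (-1) ^ length Xs * \<eta> (As @ Xs @ a # Bs) x"
  using assms(2)
proof (induction Xs arbitrary: As)
  case (Cons y Xs)
  have "\<eta> (As @ a # y # Xs @ Bs) x = - \<eta> ((As @ [y]) @ a # Xs @ Bs) x"
    using alt_forms_adjacent_swap[OF \<eta>, of As a y "Xs @ Bs"] Cons.prems by simp
  also have "\<dots> = - ((-1) ^ length Xs * \<eta> ((As @ [y]) @ Xs @ a # Bs) x)"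
    using Cons.prems by (subst Cons.IH) auto
  finally show ?case by simp
qed simp

text \<open>A 1-form leaves only \<open>p = 1\<close> in the wedge. The shuffle selecting entry
  \<open>k\<close> for it has sign (-1)^k, and moving \<open>V\<close> from the front into the
  vacated slot \<open>k\<close> gives the same sign again, so no sign survives.\<close>

lemma wedge_d_rho_int_prod:
  assumes V: "V \<in> sects" and f: "f \<in> smooth_functions \<A>" and \<eta>: "\<eta> \<in> alt_forms \<A> E"
    and Vs: "set Vs \<subseteq> sects"
  shows "wedge (d_rho \<A> E \<rho> f) (int_prod V \<eta>) Vs = (\<Sum>k<length Vs. lie (Vs ! k) f * \<eta> (Vs[k := V]))"
proof (cases Vs)
  \<comment> \<open>For the empty list the degree 1 does not occur in the sum; the single term has
    \<open>d_rho\<close> on the empty list, which is 0.\<close>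
  case Nil
  then show ?thesis by (simp add: wedge_def d_rho_def fun_eq_iff)
next
  case (Cons W Ws)
  let ?n = "length Vs" and ?df = "d_rho \<A> E \<rho> f"
  have n: "1 \<le> ?n" "?n = Suc (?n - 1)" using Cons by simp_all
  have "wedge ?df (int_prod V \<eta>) Vs x = (\<Sum>k<?n. lie (Vs ! k) f x * \<eta> (Vs[k := V]) x)" for x
  proof -
    have "wedge ?df (int_prod V \<eta>) Vs x = (\<Sum>p\<in>{1}. \<Sum>\<sigma>\<in>shuffles_perm p (?n - p).
        of_int (sign \<sigma>) * ?df (map (\<lambda>i. Vs ! \<sigma> i) [0..<p]) x *
          int_prod V \<eta> (map (\<lambda>i. Vs ! \<sigma> i) [p..<?n]) x)"
      unfolding wedge_def using n(1) by (intro sum.mono_neutral_right) (auto simp: d_rho_def)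
    also have "\<dots> = (\<Sum>k\<le>?n - 1. (-1) ^ k * ?df [Vs ! k] x * \<eta> (V # take k Vs @ drop (Suc k) Vs) x)"
      unfolding sum.insert[OF finite.emptyI] sum_shuffles_perm_1
      using n by (simp add: sum_shuffles_perm_1[simplified] sign_front_cycle int_prod_def
          map_front_cycle[simplified] front_cycle_def[of _ 0])
    also have "\<dots> = (\<Sum>k<?n. lie (Vs ! k) f x * \<eta> (Vs[k := V]) x)"
    proof (rule sum.cong)
      fix k assume "k \<in> {..<?n}"
      then have k: "k < ?n" by simp
      have "set ([] @ V # take k Vs @ drop (Suc k) Vs) \<subseteq> sects"
        using V Vs set_take_subset[of k Vs] set_drop_subset[of "Suc k" Vs] by auto
      from alt_forms_move_front[OF \<eta> this, of x]
      have "\<eta> (V # take k Vs @ drop (Suc k) Vs) x = (-1) ^ k * \<eta> (Vs[k := V]) x"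
        using k by (simp add: upd_conv_take_nth_drop)
      moreover have "?df [Vs ! k] x = lie (Vs ! k) f x"
        using nth_sections[OF Vs k] by (simp add: d_rho_def lie_fun_def)
      ultimately show "(-1) ^ k * ?df [Vs ! k] x * \<eta> (V # take k Vs @ drop (Suc k) Vs) x =
          lie (Vs ! k) f x * \<eta> (Vs[k := V]) x"
        by (simp flip: power_add)
    qed (use n in auto)
    finally show ?thesis .
  qed
  then show ?thesis by (simp add: fun_eq_iff sum_fun_apply)
qed

text \<open>A nonzero summand forces all arguments of both factors to be sections; as \<sigma> is
  onto, these include every entry of \<open>Vs\<close>.\<close>

lemma wedge_d_rho_int_prod_off:
  assumes \<eta>: "\<eta> \<in> alt_forms \<A> E" and Vs: "\<not> set Vs \<subseteq> sects"
  shows "wedge (d_rho \<A> E \<rho> f) (int_prod V \<eta>) Vs = 0"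
proof
  fix x
  let ?n = "length Vs"
  have zero: "d_rho \<A> E \<rho> f (map (\<lambda>i. Vs ! \<sigma> i) [0..<p]) x *
      int_prod V \<eta> (map (\<lambda>i. Vs ! \<sigma> i) [p..<?n]) x = 0"
    if p: "p \<le> ?n" and \<sigma>: "\<sigma> \<in> shuffles_perm p (?n - p)" for p \<sigma>
  proof (rule ccontr)
    assume nz: "\<not> ?thesis"
    have perm: "\<sigma> permutes {..<?n}" using shuffles_perm_permutes[OF \<sigma>] p by simp
    have "set (map (\<lambda>i. Vs ! \<sigma> i) [0..<p]) \<subseteq> sects"
      using nz by (auto simp: d_rho_def split: if_splits)
    moreover have "set (V # map (\<lambda>i. Vs ! \<sigma> i) [p..<?n]) \<subseteq> sects"
    proof (rule ccontr)
      assume "\<not> ?thesis"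
      from alt_forms_off[OF \<eta> this] show False using nz by (simp add: int_prod_def)
    qed
    ultimately have "Vs ! \<sigma> i \<in> sects" if "i < ?n" for i
      using that by (cases "i < p") auto
    then have "Vs ! i \<in> sects" if "i < ?n" for i
      using that permutes_image[OF perm] by (metis imageE lessThan_iff)
    then show False using Vs by (auto simp: set_conv_nth)
  qed
  show "wedge (d_rho \<A> E \<rho> f) (int_prod V \<eta>) Vs x = 0 x"
    unfolding wedge_def zero_fun_apply
    by (intro sum.neutral ballI) (simp only: mult.assoc zero mult_zero_right atMost_iff)
qed

text \<open>The derivative term of {f V, V_k} replaces V_k by V, with coefficient -\<L>(V_k) f.
  Subtracting these terms over all k gives the sum computed in
  \<open>wedge_d_rho_int_prod\<close>.\<close>

lemma Lform_sec_scale: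
  assumes V: "V \<in> sects" and f: "f \<in> smooth_functions \<A>" and \<eta>: "\<eta> \<in> alt_forms \<A> E"
  shows "Lform (sec_scale E f V) \<eta> =
    (\<lambda>Vs. f * Lform V \<eta> Vs) + wedge (d_rho \<A> E \<rho> f) (int_prod V \<eta>)"
proof
  fix Vs
  show "Lform (sec_scale E f V) \<eta> Vs =
      ((\<lambda>Vs. f * Lform V \<eta> Vs) + wedge (d_rho \<A> E \<rho> f) (int_prod V \<eta>)) Vs"
  proof (cases "set Vs \<subseteq> sects")
    case Vs: True
    have "\<eta> (Vs[k := br (sec_scale E f V) (Vs ! k)]) =
        f * \<eta> (Vs[k := br V (Vs ! k)]) - lie (Vs ! k) f * \<eta> (Vs[k := V])" if k: "k < length Vs" for k
      using k V f
      by (simp add: br_scale_fun_left alt_forms_sec_add[OF \<eta>] alt_forms_sec_scale[OF \<eta>] form_closed Vs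
          lie_smooth smooth_functions_uminus[OF base])
    then have "(\<Sum>k<length Vs. \<eta> (Vs[k := br (sec_scale E f V) (Vs ! k)])) =
        f * (\<Sum>k<length Vs. \<eta> (Vs[k := br V (Vs ! k)])) -
        (\<Sum>k<length Vs. lie (Vs ! k) f * \<eta> (Vs[k := V]))"
      by (simp add: sum_subtractf sum_distrib_left)
    then show ?thesis
      by (simp add: Lform_on[OF Vs] wedge_d_rho_int_prod[OF V f \<eta> Vs] lie_sec_scale[OF V f]
          alt_forms_smooth[OF \<eta> Vs] right_diff_distrib)
  qed (simp add: Lform_off wedge_d_rho_int_prod_off[OF \<eta>])
qed

end

text \<open>Being a derivation of degree 0 is unfolded in the third clause: linearity and
  preservation of each degree are claims about the formula \<open>lie_form\<close>, not part of its
  type, so they stand beside the product rule.\<close>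

theorem proposition5p1p4:
  fixes \<A> :: "('m::{t2_space,second_countable_topology}, 'a::real_inner) chart set"
    and E :: "('e, 'm, 'v::real_inner) vbundle"
    and br :: "('m \<Rightarrow> 'e) \<Rightarrow> ('m \<Rightarrow> 'e) \<Rightarrow> ('m \<Rightarrow> 'e)"
    and \<rho> :: "'e \<Rightarrow> ('m, 'a) tvector"
  assumes "lie_algebroid \<A> E br \<rho>"
  shows
    "(\<forall>V\<in>sections \<A> E. \<forall>f\<in>smooth_functions \<A>.
        lie_form \<A> E br \<rho> V (d_rho \<A> E \<rho> f) = d_rho \<A> E \<rho> (lie_fun \<A> (\<rho> \<circ> V) f))
     \<and>
     (\<forall>V\<in>sections \<A> E. \<forall>W\<in>sections \<A> E. \<forall>\<eta>\<in>forms \<A> E.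
        int_prod (br V W) \<eta> =
          lie_form \<A> E br \<rho> V (int_prod W \<eta>) - int_prod W (lie_form \<A> E br \<rho> V \<eta>))
     \<and>
     (\<forall>V\<in>sections \<A> E.
        (\<forall>p. \<forall>\<eta>\<in>forms_deg \<A> E p. lie_form \<A> E br \<rho> V \<eta> \<in> forms_deg \<A> E p) \<and>
        (\<forall>\<eta>\<in>forms \<A> E. \<forall>\<zeta>\<in>forms \<A> E.
           lie_form \<A> E br \<rho> V (\<eta> + \<zeta>) = lie_form \<A> E br \<rho> V \<eta> + lie_form \<A> E br \<rho> V \<zeta>) \<and>
        (\<forall>r::real. \<forall>\<eta>\<in>forms \<A> E.
           lie_form \<A> E br \<rho> V (\<lambda>Vs x. r * \<eta> Vs x) = (\<lambda>Vs x. r * lie_form \<A> E br \<rho> V \<eta> Vs x)) \<and>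
        (\<forall>\<eta>\<in>forms \<A> E. \<forall>\<zeta>\<in>forms \<A> E.
           lie_form \<A> E br \<rho> V (wedge \<eta> \<zeta>) =
             wedge (lie_form \<A> E br \<rho> V \<eta>) \<zeta> + wedge \<eta> (lie_form \<A> E br \<rho> V \<zeta>)))
     \<and>
     (\<forall>V\<in>sections \<A> E. \<forall>W\<in>sections \<A> E. \<forall>\<eta>\<in>forms \<A> E.
        lie_form \<A> E br \<rho> (br V W) \<eta> =
          lie_form \<A> E br \<rho> V (lie_form \<A> E br \<rho> W \<eta>) -
          lie_form \<A> E br \<rho> W (lie_form \<A> E br \<rho> V \<eta>))
     \<and>
     (\<forall>V\<in>sections \<A> E. \<forall>f\<in>smooth_functions \<A>. \<forall>\<eta>\<in>forms \<A> E.
        lie_form \<A> E br \<rho> (sec_scale E f V) \<eta> =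
          (\<lambda>Vs. f * lie_form \<A> E br \<rho> V \<eta> Vs) + wedge (d_rho \<A> E \<rho> f) (int_prod V \<eta>))"
proof -
  interpret lie_algebroid \<A> E br \<rho> by (rule assms)
  note alt = forms_alt_forms[OF base]
  show ?thesis
    by (intro conjI ballI allI)
      (erule (1) Lform_d_rho int_prod_br[OF _ _ alt] Lform_forms_deg Lform_add[OF _ alt alt]
        Lform_cmult[OF _ alt] Lform_wedge[OF _ alt alt] Lform_br[OF _ _ alt]
        Lform_sec_scale[OF _ _ alt]; assumption)+
qed

end
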